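(* Let $(\Gamma,p)$ be a framework in the hyperbolic space $\mathbb{H}^d$ or in the sphere $\mathbb{S}^d$, and let $(\Gamma,\bar p)$ be a geodesic Euclidean image of it. Then $(\Gamma,p)$ and $(\Gamma,\bar p)$ have the same number of kinematic degrees of freedom. In particular, $(\Gamma,p)$ is infinitesimally rigid if and only if $(\Gamma,\bar p)$ is infinitesimally rigid.
   Context: Spaces: $\mathbb{S}^d=\{x\in\mathbb{R}^{d+1}\mid\langle x,x\rangle=1\}$ with the Euclidean product $\langle x,y\rangle=x_0y_0+\dots+x_dy_d$; $\mathbb{H}^d=\{x\in\mathbb{R}^{d+1}\mid\langle x,x\rangle=-1,\ x_0>0\}$ with the Minkowski product $\langle x,y\rangle=-x_0y_0+x_1y_1+\dots+x_dy_d$; $\mathbb{E}^d=\{x\in\mathbb{R}^{d+1}\mid x_0=1\}$ is Euclidean space. $\mathbb{X}^d$ denotes any of these, with its usual metric. Geodesic Euclidean image: for a hyperbolic framework, its representation in the Beltrami--Cayley--Klein model, i.e. $\bar p_i=p_i/(p_i)_0\in\mathbb{E}^d$, the projection of $p_i$ from the origin to $\{x_0=1\}$. For a spherical framework, its projection from the center of the sphere (the origin) to an affine hyperplane $A\subset\mathbb{R}^{d+1}$ not containing the origin, regarded as a Euclidean $d$-space; it is assumed that the projection is defined at all vertices, i.e. no $p_i$ lies in the linear hyperplane parallel to $A$, and $\bar p_i$ is the intersection point of $A$ with the line $\mathbb{R}p_i$. Frameworks: $\Gamma$ is a finite simple graph with vertex set $\Gamma_0$ and edge set $\Gamma_1$.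 A framework $(\Gamma,p)$ in $\mathbb{X}^d$ is a map $p\colon\Gamma_0\to\mathbb{X}^d$ with $p_i\neq p_j$ for all $ij\in\Gamma_1$, and if $\mathbb{X}=\mathbb{S}$ additionally $p_i\ne-p_j$ for all $ij\in\Gamma_1$. Kinematics: a vector field on $(\Gamma,p)$ is a map $i\mapsto q_i\in T_{p_i}\mathbb{X}^d$. It is an infinitesimal isometric deformation if for some (equivalently, every) smooth family $(\Gamma,p(t))$ with $p(0)=p$, $\dot p_i(0)=q_i$, one has $\frac{d}{dt}|_{t=0}\operatorname{dist}(p_i(t),p_j(t))=0$ for all $ij\in\Gamma_1$. It is trivial if there is a Killing field $K$ on $\mathbb{X}^d$ with $q_i=K(p_i)$ for all $i$. $V(\Gamma,p)$, $V_0(\Gamma,p)$ are the spaces of all, respectively trivial, infinitesimal isometric deformations. The number of kinematic degrees of freedom is $\dim V(\Gamma,p)/V_0(\Gamma,p)$; the framework is infinitesimally rigid if this number is $0$. *)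

theory Defs
  imports "HOL-Analysis.Analysis"
begin

text \<open>
  The ambient space \<open>\<real>\<^bsup>d+1\<^esup>\<close> is \<open>real \<times> (real ^ 'd)\<close> with \<open>d = CARD('d)\<close>: \<open>fst x\<close> is the coordinate
  \<open>x\<^sub>0\<close> and \<open>snd x\<close> collects \<open>x\<^sub>1, \<dots>, x\<^sub>d\<close>. The library inner product of this type is the
  Euclidean product \<open>x\<^sub>0 y\<^sub>0 + \<dots> + x\<^sub>d y\<^sub>d\<close>.
\<close>

type_synonym 'd ambient = "real \<times> (real ^ 'd)"

definition minkowski :: "'d::finite ambient \<Rightarrow> 'd ambient \<Rightarrow> real" where
  "minkowski x y = - (fst x * fst y) + snd x \<bullet> snd y"

text \<open>
  Euclidean \<open>d\<close>-space is realised as an arbitrary affine hyperplane \<open>A\<close> of the ambient space;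
  the standard model is \<open>A = {x. fst x = 1}\<close>.
\<close>

datatype 'd geometry = Spherical | Hyperbolic | Euclidean "'d ambient set"

fun points :: "'d::finite geometry \<Rightarrow> 'd ambient set" where
  "points Spherical = {x. x \<bullet> x = 1}"
| "points Hyperbolic = {x. minkowski x x = -1 \<and> fst x > 0}"
| "points (Euclidean A) = A"

text \<open>The form that induces the Riemannian metric on the tangent spaces.\<close>

fun metric_form :: "'d::finite geometry \<Rightarrow> 'd ambient \<Rightarrow> 'd ambient \<Rightarrow> real" where
  "metric_form Spherical u v = u \<bullet> v"
| "metric_form Hyperbolic u v = minkowski u v"
| "metric_form (Euclidean A) u v = u \<bullet> v"

fun geo_dist :: "'d::finite geometry \<Rightarrow> 'd ambient \<Rightarrow> 'd ambient \<Rightarrow> real" where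
  "geo_dist Spherical x y = arccos (x \<bullet> y)"
| "geo_dist Hyperbolic x y = arcosh (- minkowski x y)"
| "geo_dist (Euclidean A) x y = dist x y"

text \<open>\<open>C\<^sup>k\<close> and \<open>C\<^sup>\<infinity>\<close> maps on an open set.\<close>

primrec Ck_on :: "nat \<Rightarrow> 'a::real_normed_vector set \<Rightarrow> ('a \<Rightarrow> 'b::real_normed_vector) \<Rightarrow> bool" where
  "Ck_on 0 U f \<longleftrightarrow> continuous_on U f"
| "Ck_on (Suc k) U f \<longleftrightarrow> (\<forall>x\<in>U. f differentiable (at x)) \<and>
     (\<forall>v. Ck_on k U (\<lambda>x. frechet_derivative f (at x) v))"

definition smooth_on :: "'a::real_normed_vector set \<Rightarrow> ('a \<Rightarrow> 'b::real_normed_vector) \<Rightarrow> bool" where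
  "smooth_on U f \<longleftrightarrow> (\<forall>k. Ck_on k U f)"

definition tangent_space :: "'a::real_normed_vector set \<Rightarrow> 'a \<Rightarrow> 'a set" where
  "tangent_space X x = {v. \<exists>e>0. \<exists>c::real \<Rightarrow> 'a.
     smooth_on {-e<..<e} c \<and> c ` {-e<..<e} \<subseteq> X \<and> c 0 = x \<and> (c has_vector_derivative v) (at 0)}"

text \<open>
  A Killing field is a smooth tangent vector field \<open>K\<close> with
  \<open>g(\<nabla>\<^sub>u K, v) + g(u, \<nabla>\<^sub>v K) = 0\<close> for all tangent \<open>u\<close>, \<open>v\<close>. As usual for submanifolds, \<open>K\<close> is given by a
  smooth map on an ambient neighbourhood. The Levi-Civita derivative \<open>\<nabla>\<^sub>u K\<close> is the part of the
  ambient derivative of \<open>K\<close> along \<open>u\<close> that is tangent to the space; the other part is orthogonal to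
  the tangent space with respect to the form, and drops out of the equation.
\<close>

definition killing_field :: "'d::finite geometry \<Rightarrow> ('d ambient \<Rightarrow> 'd ambient) \<Rightarrow> bool" where
  "killing_field M K \<longleftrightarrow>
     (\<exists>U. open U \<and> points M \<subseteq> U \<and> smooth_on U K) \<and>
     (\<forall>x\<in>points M. K x \<in> tangent_space (points M) x) \<and>
     (\<forall>x\<in>points M. \<forall>u\<in>tangent_space (points M) x. \<forall>v\<in>tangent_space (points M) x.
        metric_form M (frechet_derivative K (at x) u) v
        + metric_form M u (frechet_derivative K (at x) v) = 0)"

text \<open>
  The vertex set of a finite simple graph is a finite type \<open>'v\<close>; its edges are two-element sets.
\<close>

definition simple_graph :: "'v::finite set set \<Rightarrow> bool" where
  "simple_graph E \<longleftrightarrow> (\<forall>e\<in>E. card e = 2)"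

definition framework :: "'d::finite geometry \<Rightarrow> 'v::finite set set \<Rightarrow> 'd ambient ^ 'v \<Rightarrow> bool" where
  "framework M E p \<longleftrightarrow>
     (\<forall>i. p $ i \<in> points M) \<and>
     (\<forall>i j. {i, j} \<in> E \<longrightarrow> p $ i \<noteq> p $ j) \<and>
     (M = Spherical \<longrightarrow> (\<forall>i j. {i, j} \<in> E \<longrightarrow> p $ i \<noteq> - (p $ j)))"

definition vector_field_on :: "'d::finite geometry \<Rightarrow> 'd ambient ^ 'v::finite \<Rightarrow> 'd ambient ^ 'v \<Rightarrow> bool" where
  "vector_field_on M p q \<longleftrightarrow> (\<forall>i. q $ i \<in> tangent_space (points M) (p $ i))"

definition isometric_deformation ::
    "'d::finite geometry \<Rightarrow> 'v::finite set set \<Rightarrow> 'd ambient ^ 'v \<Rightarrow> 'd ambient ^ 'v \<Rightarrow> bool" where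
  "isometric_deformation M E p q \<longleftrightarrow> vector_field_on M p q \<and>
     (\<exists>e>0. \<exists>c::real \<Rightarrow> 'd ambient ^ 'v.
        smooth_on {-e<..<e} c \<and> (\<forall>t\<in>{-e<..<e}. framework M E (c t)) \<and>
        c 0 = p \<and> (c has_vector_derivative q) (at 0) \<and>
        (\<forall>i j. {i, j} \<in> E \<longrightarrow>
           ((\<lambda>t. geo_dist M (c t $ i) (c t $ j)) has_real_derivative 0) (at 0)))"

definition deformations ::
    "'d::finite geometry \<Rightarrow> 'v::finite set set \<Rightarrow> 'd ambient ^ 'v \<Rightarrow> ('d ambient ^ 'v) set" where
  "deformations M E p = {q. isometric_deformation M E p q}"

definition trivial_deformations ::
    "'d::finite geometry \<Rightarrow> 'v::finite set set \<Rightarrow> 'd ambient ^ 'v \<Rightarrow> ('d ambient ^ 'v) set" where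
  "trivial_deformations M E p =
     {q \<in> deformations M E p. \<exists>K. killing_field M K \<and> (\<forall>i. q $ i = K (p $ i))}"

text \<open>
  The dimension of the quotient of the finite-dimensional space \<open>deformations M E p\<close> by its subspace
  \<open>trivial_deformations M E p\<close>; the truncated subtraction is exact because of the inclusion.
\<close>

definition kinematic_dof :: "'d::finite geometry \<Rightarrow> 'v::finite set set \<Rightarrow> 'd ambient ^ 'v \<Rightarrow> nat" where
  "kinematic_dof M E p = dim (deformations M E p) - dim (trivial_deformations M E p)"

definition infinitesimally_rigid ::
    "'d::finite geometry \<Rightarrow> 'v::finite set set \<Rightarrow> 'd ambient ^ 'v \<Rightarrow> bool" where
  "infinitesimally_rigid M E p \<longleftrightarrow> kinematic_dof M E p = 0"

text \<open>
  \<open>pbar\<close> is a geodesic Euclidean image of \<open>p\<close> in the affine hyperplane \<open>A\<close>. In the spherical case the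
  condition \<open>pbar $ i \<in> A \<inter> span {p $ i}\<close> says that the line through \<open>0\<close> and \<open>p $ i\<close> meets \<open>A\<close> (so that
  \<open>p $ i\<close> is not in the linear hyperplane parallel to \<open>A\<close>) and that \<open>pbar $ i\<close> is the intersection
  point, which is unique because \<open>0 \<notin> A\<close>.
\<close>

fun geodesic_euclidean_image ::
    "'d::finite geometry \<Rightarrow> 'd ambient set \<Rightarrow> 'd ambient ^ 'v::finite \<Rightarrow> 'd ambient ^ 'v \<Rightarrow> bool" where
  "geodesic_euclidean_image Hyperbolic A p pbar \<longleftrightarrow>
     A = {x. fst x = 1} \<and> (\<forall>i. pbar $ i = (1 / fst (p $ i)) *\<^sub>R (p $ i))"
| "geodesic_euclidean_image Spherical A p pbar \<longleftrightarrow>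
     affine A \<and> aff_dim A = int CARD('d) \<and> 0 \<notin> A \<and> (\<forall>i. pbar $ i \<in> A \<inter> span {p $ i})"
| "geodesic_euclidean_image (Euclidean B) A p pbar \<longleftrightarrow> False"

text \<open>The image is again a framework, so that its degrees of freedom are meaningful.\<close>

lemma framework_geodesic_euclidean_image:
  fixes M :: "'d::finite geometry" and p pbar :: "'d ambient ^ 'v::finite"
  assumes fw: "framework M E p" and im: "geodesic_euclidean_image M A p pbar"
  shows "framework (Euclidean A) E pbar"
proof (cases M)
  case Hyperbolic
  have A: "A = {x. fst x = 1}" and pb: "\<And>i. pbar $ i = (1 / fst (p $ i)) *\<^sub>R (p $ i)"
    using im Hyperbolic by auto
  have pos: "fst (p $ i) > 0" and nrm: "minkowski (p $ i) (p $ i) = -1" for i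
    using fw Hyperbolic by (auto simp: framework_def)
  have "pbar $ i \<noteq> pbar $ j" if "{i, j} \<in> E" for i j
  proof
    assume eq: "pbar $ i = pbar $ j"
    define r where "r = fst (p $ i) / fst (p $ j)"
    have r: "r > 0" using pos by (simp add: r_def)
    have "p $ i = fst (p $ i) *\<^sub>R (pbar $ i)" using pos[of i] by (simp add: pb)
    also have "\<dots> = r *\<^sub>R (p $ j)" by (simp add: eq) (simp add: pb r_def)
    finally have ij: "p $ i = r *\<^sub>R (p $ j)" .
    have "minkowski (p $ i) (p $ i) = r^2 * minkowski (p $ j) (p $ j)"
      by (simp add: ij minkowski_def power2_eq_square algebra_simps)
    hence "r^2 = 1" using nrm by simp
    hence "r = 1" using r by (simp add: power2_eq_1_iff)
    thus False using ij fw that by (auto simp: framework_def)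
  qed
  thus ?thesis using pos by (auto simp: framework_def A pb less_imp_neq[symmetric])
next
  case Spherical
  have A0: "0 \<notin> A" and pA: "\<And>i. pbar $ i \<in> A" and ps: "\<And>i. pbar $ i \<in> span {p $ i}"
    using im Spherical by auto
  have nrm: "norm (p $ i) = 1" for i
    using fw Spherical by (auto simp: framework_def norm_eq_sqrt_inner)
  have "pbar $ i \<noteq> pbar $ j" if "{i, j} \<in> E" for i j
  proof
    assume eq: "pbar $ i = pbar $ j"
    obtain r s where r: "pbar $ i = r *\<^sub>R (p $ i)" and s: "pbar $ j = s *\<^sub>R (p $ j)"
      using ps[of i] ps[of j] by (auto simp: span_singleton)
    have "r \<noteq> 0" using A0 pA[of i] r by auto
    moreover have rs: "r *\<^sub>R (p $ i) = s *\<^sub>R (p $ j)" using eq r s by simp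
    hence "\<bar>r\<bar> = \<bar>s\<bar>" using nrm by (metis norm_scaleR mult.right_neutral)
    hence "s = r \<or> s = - r" by (auto simp: abs_if split: if_splits)
    ultimately have "p $ i = p $ j \<or> p $ i = - (p $ j)"
      using rs by (metis scaleR_left_imp_eq scaleR_minus_left scaleR_minus_right)
    thus False using fw Spherical that by (auto simp: framework_def)
  qed
  thus ?thesis using pA by (auto simp: framework_def)
next
  case (Euclidean B)
  thus ?thesis using im by simp
qed

end

theory Submission imports Defs begin

text \<open>
  Let \<open>J\<close> be the identity for the sphere and the reflection \<open>x\<^sub>0 \<mapsto> -x\<^sub>0\<close> for hyperbolic space, so that
  the form of the geometry is \<open>\<langle>J u, v\<rangle>\<close> with the Euclidean product. In both cases the hyperplane is
  \<open>A = {x. \<langle>n, x\<rangle> = 1}\<close> for some \<open>n\<close>, and the image of \<open>p\<^sub>i\<close> is \<open>r\<^sub>i p\<^sub>i\<close> with \<open>r\<^sub>i \<noteq> 0\<close>.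

  A field \<open>q\<close> is an infinitesimal isometric deformation of \<open>p\<close> iff \<open>\<langle>J q\<^sub>i, p\<^sub>i\<rangle> = 0\<close> for all vertices and
  \<open>\<langle>J q\<^sub>i, p\<^sub>j\<rangle> + \<langle>J q\<^sub>j, p\<^sub>i\<rangle> = 0\<close> for all edges (\<open>mem_deformations_quadric\<close>). Multiplying by \<open>r\<^sub>i r\<^sub>j\<close>,
  the vectors \<open>w\<^sub>i = r\<^sub>i J q\<^sub>i\<close> satisfy the same equations for the image points \<open>r\<^sub>i p\<^sub>i\<close>, and hence are
  orthogonal along the edges in the sense \<open>\<langle>w\<^sub>i - w\<^sub>j, r\<^sub>i p\<^sub>i - r\<^sub>j p\<^sub>j\<rangle> = 0\<close>. Since the differences of the
  image points are orthogonal to \<open>n\<close>, projecting \<open>w\<^sub>i\<close> orthogonally to the directions of \<open>A\<close> yields a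
  deformation of the image (\<open>mem_deformations_hyperplane\<close>). Conversely the normal component of \<open>w\<^sub>i\<close> is
  determined by \<open>\<langle>w\<^sub>i, r\<^sub>i p\<^sub>i\<rangle> = 0\<close>. This is a linear isomorphism between the spaces of deformations.

  It remains to match the trivial deformations. A Killing field has a constant product with the
  velocity of every geodesic. Comparing the end points of geodesics shows that \<open>J K\<close> (on a quadric),
  or \<open>K\<close> with a suitable normal component added (on \<open>A\<close>), satisfies \<open>\<langle>f x, y\<rangle> + \<langle>f y, x\<rangle> = 0\<close> for
  all pairs of points. As the points span the ambient space, \<open>f\<close> is the restriction of a skew linear
  map \<open>B\<close> (\<open>skew_on_spanning_set_is_linear\<close>). Trivial deformations are therefore exactly those with
  \<open>J q\<^sub>i = B p\<^sub>i\<close>, respectively those that are the projection of \<open>B (r\<^sub>i p\<^sub>i)\<close>, and by linearity of \<open>B\<close> the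
  isomorphism carries the former onto the latter (\<open>kinematic_dof_projection\<close>).
\<close>

section \<open>Smooth curves and linear maps\<close>

lemma frechet_derivative_eq_on_open:
  assumes "open U" "x \<in> U" "\<And>y. y \<in> U \<Longrightarrow> f y = g y" "f differentiable (at x)"
  shows "frechet_derivative g (at x) = frechet_derivative f (at x)" "g differentiable (at x)"
proof -
  have "(f has_derivative frechet_derivative f (at x)) (at x)"
    using assms(4) by (simp add: frechet_derivative_works)
  then have "(g has_derivative frechet_derivative f (at x)) (at x)"
    by (rule has_derivative_transform_within_open[OF _ assms(1,2,3)])
  then show "frechet_derivative g (at x) = frechet_derivative f (at x)" "g differentiable (at x)"
    by (auto dest: frechet_derivative_at simp: differentiable_def)
qed

lemma Ck_on_cong:
  assumes "open U" "\<And>x. x \<in> U \<Longrightarrow> f x = g x" "Ck_on k U f"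
  shows "Ck_on k U g"
  using assms(2,3)
proof (induction k arbitrary: f g)
  case 0
  then show ?case by (simp cong: continuous_on_cong)
next
  case (Suc k)
  have d: "f differentiable (at x)" if "x \<in> U" for x
    using Suc.prems(2) that by simp
  have "g differentiable (at x)" if "x \<in> U" for x
    using frechet_derivative_eq_on_open(2)[OF assms(1) that, of f g] Suc.prems(1) d[OF that] by blast
  moreover have "Ck_on k U (\<lambda>x. frechet_derivative g (at x) v)" for v
  proof (rule Suc.IH)
    show "frechet_derivative f (at x) v = frechet_derivative g (at x) v" if "x \<in> U" for x
      using frechet_derivative_eq_on_open(1)[OF assms(1) that, of f g] Suc.prems(1) d[OF that] by simp
    show "Ck_on k U (\<lambda>x. frechet_derivative f (at x) v)"
      using Suc.prems(2) by simp
  qed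
  ultimately show ?case by simp
qed

lemma Ck_on_const: "Ck_on k U (\<lambda>x. c)"
  by (induction k arbitrary: c) auto

lemma smooth_on_linear:
  fixes f :: "'a::euclidean_space \<Rightarrow> 'b::real_normed_vector"
  assumes "linear f"
  shows "smooth_on U f"
proof -
  have bl: "bounded_linear f" using assms by (simp add: linear_conv_bounded_linear)
  then have "(f has_derivative f) (at x)" for x by (rule bounded_linear_imp_has_derivative)
  then have "frechet_derivative f (at x) = f" "f differentiable (at x)" for x
    by (auto dest: frechet_derivative_at[symmetric] simp: differentiable_def)
  then have "Ck_on k U f" for k
    using bl by (cases k) (auto simp: Ck_on_const intro: linear_continuous_on)
  then show ?thesis by (simp add: smooth_on_def)
qed

text \<open>
  The Frechet derivative of a curve in the direction \<open>h\<close> is \<open>h\<close> times its vector derivative. Hence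
  the induction has to run over all scalar multiples of all the derivatives simultaneously.
\<close>

lemma smooth_on_iterated_derivatives:
  fixes F :: "nat \<Rightarrow> real \<Rightarrow> 'a::real_normed_vector"
  assumes "\<And>n t. (F n has_vector_derivative F (Suc n) t) (at t)" and "open U"
  shows "smooth_on U (F 0)"
proof -
  have "Ck_on k U (\<lambda>t. a *\<^sub>R F n t)" for k a n
  proof (induction k arbitrary: a n)
    case 0
    have "continuous_on U (F n)" using assms(1)
      by (meson continuous_at_imp_continuous_on has_vector_derivative_continuous)
    then show ?case by (auto intro: continuous_intros)
  next
    case (Suc k)
    have D: "((\<lambda>t. a *\<^sub>R F n t) has_derivative (\<lambda>h. (h * a) *\<^sub>R F (Suc n) t)) (at t)" for t
      using has_derivative_scaleR_right[OF assms(1)[unfolded has_vector_derivative_def], of a n t]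
      by (simp add: mult.commute)
    have "frechet_derivative (\<lambda>t. a *\<^sub>R F n t) (at t) = (\<lambda>h. (h * a) *\<^sub>R F (Suc n) t)" for t
      using frechet_derivative_at[OF D] by simp
    then show ?case using D Suc.IH by (auto simp: differentiable_def)
  qed
  from this[of _ 1 0] show ?thesis by (simp add: smooth_on_def)
qed

lemma has_vector_derivative_vec_lambda:
  fixes f :: "'i::finite \<Rightarrow> real \<Rightarrow> 'a::real_normed_vector"
  assumes "\<And>i. (f i has_vector_derivative f' i) (at t)"
  shows "((\<lambda>t. \<chi> i. f i t) has_vector_derivative (\<chi> i. f' i)) (at t)"
proof -
  let ?q = "\<lambda>g g' s. (1 / \<bar>s - t\<bar>) *\<^sub>R (g s - (g t + (s - t) *\<^sub>R g'))"
  have "(?q (f i) (f' i) \<longlongrightarrow> 0) (at t)" for i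
    using assms[of i] by (auto simp: has_vector_derivative_def has_derivative_within)
  then have "((\<lambda>s. \<chi> i. ?q (f i) (f' i) s) \<longlongrightarrow> (\<chi> i. 0)) (at t)"
    by (intro tendsto_vec_lambda) auto
  moreover have "(\<chi> i. ?q (f i) (f' i) s) = (1 / \<bar>s - t\<bar>) *\<^sub>R
      ((\<chi> i. f i s) - ((\<chi> i. f i t) + (s - t) *\<^sub>R (\<chi> i. f' i)))" for s
    by (simp add: vec_eq_iff)
  moreover have "(\<chi> i. 0) = (0 :: 'a ^ 'i)" by (simp add: vec_eq_iff)
  ultimately show ?thesis
    by (simp add: has_vector_derivative_def has_derivative_within bounded_linear_scaleR_left)
qed

lemma has_vector_derivative_vec_nth:
  assumes "(c has_vector_derivative q) (at t)"
  shows "((\<lambda>t. c t $ i) has_vector_derivative q $ i) (at t)"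
  using bounded_linear.has_vector_derivative[OF bounded_linear_vec_nth assms] .

section \<open>Geodesics\<close>

text \<open>
  In the three models every geodesic solves a linear equation \<open>\<gamma>'' = k \<gamma>\<close> in the ambient space:
  \<open>k < 0\<close> for great circles, \<open>k > 0\<close> for hyperbolas and \<open>k = 0\<close> for straight lines.
  This equation alone gives smoothness and, for a tangent field with the Killing equation, a conserved
  quantity, so that the three geometries need not be separated. The speed is arbitrary.
\<close>

definition geodesic_in ::
    "'a::real_normed_vector set \<Rightarrow> real \<Rightarrow> (real \<Rightarrow> 'a) \<Rightarrow> (real \<Rightarrow> 'a) \<Rightarrow> bool" where
  "geodesic_in X k \<gamma> \<eta> \<longleftrightarrow> (\<forall>t. \<gamma> t \<in> X \<and> (\<gamma> has_vector_derivative \<eta> t) (at t) \<and>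
     (\<eta> has_vector_derivative k *\<^sub>R \<gamma> t) (at t))"

lemma geodesic_in_reparametrise:
  assumes "geodesic_in X k \<gamma> \<eta>"
  shows "geodesic_in X (a\<^sup>2 * k) (\<lambda>t. \<gamma> (a * t + b)) (\<lambda>t. a *\<^sub>R \<eta> (a * t + b))"
  unfolding geodesic_in_def
proof (intro allI conjI)
  fix t
  have l: "((\<lambda>t. a * t + b) has_vector_derivative a) (at t)"
    unfolding has_real_derivative_iff_has_vector_derivative[symmetric]
    by (auto intro!: derivative_eq_intros)
  have 1: "(\<gamma> has_vector_derivative \<eta> (a * t + b)) (at (a * t + b))"
    and 2: "(\<eta> has_vector_derivative k *\<^sub>R \<gamma> (a * t + b)) (at (a * t + b))"
    using assms by (auto simp: geodesic_in_def)
  show "\<gamma> (a * t + b) \<in> X" using assms by (auto simp: geodesic_in_def)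
  show "((\<lambda>t. \<gamma> (a * t + b)) has_vector_derivative a *\<^sub>R \<eta> (a * t + b)) (at t)"
    using vector_diff_chain_at[OF l 1] by (simp add: o_def)
  have "((\<lambda>t. \<eta> (a * t + b)) has_vector_derivative a *\<^sub>R k *\<^sub>R \<gamma> (a * t + b)) (at t)"
    using vector_diff_chain_at[OF l 2] by (simp add: o_def)
  from bounded_linear.has_vector_derivative[OF bounded_linear_scaleR_right this, of a]
  show "((\<lambda>t. a *\<^sub>R \<eta> (a * t + b)) has_vector_derivative (a\<^sup>2 * k) *\<^sub>R \<gamma> (a * t + b)) (at t)"
    by (simp add: power2_eq_square mult.assoc)
qed

text \<open>
  The iterated derivatives of a solution of \<open>c'' = L c\<close> alternate between iterates of \<open>L\<close> on the
  position and on the velocity. With a diagonal \<open>L\<close> this covers a whole framework whose vertices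
  move along geodesics, each with its own constant.
\<close>

lemma smooth_on_linear_second_order:
  fixes c :: "real \<Rightarrow> 'a::real_normed_vector"
  assumes L: "bounded_linear L" and U: "open U"
    and c: "\<And>t. (c has_vector_derivative c' t) (at t)"
    and c': "\<And>t. (c' has_vector_derivative L (c t)) (at t)"
  shows "smooth_on U c"
proof -
  define F where "F n t = (L ^^ (n div 2)) (if even n then c t else c' t)" for n t
  have bl: "bounded_linear (L ^^ n)" for n
  proof (induction n)
    case 0
    then show ?case using bounded_linear_ident by (simp add: id_def)
  next
    case (Suc n)
    then show ?case using bounded_linear_compose[OF L] by (simp add: o_def)
  qed
  have "(F n has_vector_derivative F (Suc n) t) (at t)" for n t
    unfolding F_def
    using bounded_linear.has_vector_derivative[OF bl c, of "n div 2" t]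
      bounded_linear.has_vector_derivative[OF bl c', of "n div 2" t]
    by (cases "even n") (auto simp: funpow_swap1 elim!: oddE)
  from smooth_on_iterated_derivatives[of F, OF this U] show ?thesis by (simp add: F_def[abs_def])
qed

lemma smooth_on_geodesic:
  assumes "geodesic_in X k \<gamma> \<eta>" "open U"
  shows "smooth_on U \<gamma>"
  using assms by (intro smooth_on_linear_second_order[OF bounded_linear_scaleR_right])
    (auto simp: geodesic_in_def)

lemma smooth_on_geodesics:
  fixes \<gamma> :: "'i::finite \<Rightarrow> real \<Rightarrow> 'a::euclidean_space"
  assumes "\<And>i. geodesic_in X (k i) (\<gamma> i) (\<eta> i)" "open U"
  shows "smooth_on U (\<lambda>t. \<chi> i. \<gamma> i t)"
proof (rule smooth_on_linear_second_order[OF _ assms(2)])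
  have "linear (\<lambda>x :: 'a ^ 'i. \<chi> i. k i *\<^sub>R x $ i)"
    by (intro linearI) (auto simp: vec_eq_iff algebra_simps)
  then show "bounded_linear (\<lambda>x :: 'a ^ 'i. \<chi> i. k i *\<^sub>R x $ i)"
    by (simp add: linear_conv_bounded_linear)
  show "((\<lambda>t. \<chi> i. \<gamma> i t) has_vector_derivative (\<chi> i. \<eta> i t)) (at t)" for t
    using assms(1) by (intro has_vector_derivative_vec_lambda) (auto simp: geodesic_in_def)
  show "((\<lambda>t. \<chi> i. \<eta> i t) has_vector_derivative (\<chi> i. k i *\<^sub>R (\<chi> i. \<gamma> i t) $ i)) (at t)" for t
    using assms(1) by (intro has_vector_derivative_vec_lambda) (auto simp: geodesic_in_def)
qed

lemma geodesic_velocity_tangent: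
  assumes "geodesic_in X k \<gamma> \<eta>"
  shows "\<eta> t \<in> tangent_space X (\<gamma> t)"
proof -
  have g: "geodesic_in X k (\<lambda>s. \<gamma> (s + t)) (\<lambda>s. \<eta> (s + t))"
    using geodesic_in_reparametrise[OF assms, of 1 t] by simp
  then have "smooth_on {-1<..<1} (\<lambda>s. \<gamma> (s + t))"
    by (rule smooth_on_geodesic) simp
  moreover have "((\<lambda>s. \<gamma> (s + t)) has_vector_derivative \<eta> t) (at 0)"
    using g unfolding geodesic_in_def by (metis add_0)
  moreover have "(\<lambda>s. \<gamma> (s + t)) ` {-1<..<1} \<subseteq> X"
    using g by (auto simp: geodesic_in_def)
  ultimately show ?thesis
    unfolding tangent_space_def by (auto intro!: exI[of _ 1] exI[of _ "\<lambda>s. \<gamma> (s + t)"])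
qed

text \<open>
  The reflection \<open>J\<close> that turns the Euclidean product of the ambient space into the form of the
  geometry. It lets both quadrics be treated with Euclidean orthogonality.
\<close>

fun form_op :: "'d::finite geometry \<Rightarrow> 'd ambient \<Rightarrow> 'd ambient" where
  "form_op Hyperbolic x = (- fst x, snd x)"
| "form_op Spherical x = x"
| "form_op (Euclidean A) x = x"

lemma metric_form_form_op: "metric_form M u v = form_op M u \<bullet> v"
  by (cases M) (auto simp: minkowski_def inner_prod_def)

lemma form_op_form_op [simp]: "form_op M (form_op M x) = x"
  by (cases M) auto

lemma form_op_inner_commute: "form_op M u \<bullet> v = u \<bullet> form_op M v"
  by (cases M) (auto simp: inner_prod_def)

lemma linear_form_op: "linear (form_op M)"
  by (cases M) (auto intro!: linearI)

lemma metric_form_commute: "metric_form M u v = metric_form M v u"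
  by (metis metric_form_form_op form_op_inner_commute inner_commute)

lemma minkowski_commute: "minkowski u v = minkowski v u"
  by (simp add: minkowski_def inner_commute)

lemma minkowski_bilinear:
  "minkowski (u + v) w = minkowski u w + minkowski v w"
  "minkowski w (u + v) = minkowski w u + minkowski w v"
  "minkowski (u - v) w = minkowski u w - minkowski v w"
  "minkowski w (u - v) = minkowski w u - minkowski w v"
  "minkowski (r *\<^sub>R u) w = r * minkowski u w"
  "minkowski w (r *\<^sub>R u) = r * minkowski w u"
  by (auto simp: minkowski_def inner_add_left inner_add_right inner_diff_left inner_diff_right
      algebra_simps)

lemma line_geodesic:
  fixes x n :: "'a::euclidean_space"
  assumes "n \<bullet> x = b" "n \<bullet> v = 0"
  shows "geodesic_in {x. n \<bullet> x = b} 0 (\<lambda>t. x + t *\<^sub>R v) (\<lambda>t. v)"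
  using assms unfolding geodesic_in_def
  by (auto simp: inner_add_right intro!: derivative_eq_intros)

lemma great_circle_geodesic:
  fixes x e :: "'d::finite ambient"
  assumes "x \<bullet> x = 1" "e \<bullet> e = 1" "x \<bullet> e = 0"
  shows "geodesic_in (points Spherical) (-1)
    (\<lambda>t. cos t *\<^sub>R x + sin t *\<^sub>R e) (\<lambda>t. cos t *\<^sub>R e - sin t *\<^sub>R x)"
  unfolding geodesic_in_def
proof (intro allI conjI)
  fix t
  have "(cos t *\<^sub>R x + sin t *\<^sub>R e) \<bullet> (cos t *\<^sub>R x + sin t *\<^sub>R e) = (cos t)\<^sup>2 + (sin t)\<^sup>2"
    using assms by (simp add: inner_simps inner_commute[of e x] power2_eq_square)
  then show "cos t *\<^sub>R x + sin t *\<^sub>R e \<in> points Spherical" by simp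
qed (auto intro!: derivative_eq_intros)

text \<open>
  Both parts come from the Cauchy-Schwarz inequality for the spatial components. The second one
  makes unit speed possible in hyperbolic space and yields the strict bound on the product of two
  distinct points; the first one keeps a hyperbola on the upper sheet.
\<close>

lemma minkowski_positive_on_tangent:
  assumes "minkowski x x = -1" "fst x > 0" "minkowski x v = 0"
  shows "(fst v)\<^sup>2 \<le> minkowski v v * (fst x)\<^sup>2" and "v \<noteq> 0 \<Longrightarrow> minkowski v v > 0"
proof -
  have xs: "snd x \<bullet> snd x = (fst x)\<^sup>2 - 1" and xv: "fst x * fst v = snd x \<bullet> snd v"
    using assms by (auto simp: minkowski_def power2_eq_square)
  have "(fst x * fst v)\<^sup>2 \<le> (snd x \<bullet> snd x) * (snd v \<bullet> snd v)"
    unfolding xv by (rule Cauchy_Schwarz_ineq)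
  then have *: "snd v \<bullet> snd v \<le> minkowski v v * (fst x)\<^sup>2"
    unfolding xs minkowski_def by (simp add: power2_eq_square algebra_simps)
  have x1: "(fst x)\<^sup>2 \<ge> 1" using xs inner_ge_zero[of "snd x"] by linarith
  have nn: "minkowski v v \<ge> 0"
  proof (rule ccontr)
    assume "\<not> minkowski v v \<ge> 0"
    then have "minkowski v v * (fst x)\<^sup>2 < 0" using assms(2) by (intro mult_neg_pos) auto
    then show False using * inner_ge_zero[of "snd v"] by linarith
  qed
  have "(fst v)\<^sup>2 \<le> snd v \<bullet> snd v" using nn by (simp add: minkowski_def power2_eq_square)
  with * show "(fst v)\<^sup>2 \<le> minkowski v v * (fst x)\<^sup>2" by linarith
  show "minkowski v v > 0" if "v \<noteq> 0"
  proof (rule ccontr)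
    assume "\<not> minkowski v v > 0"
    then have "minkowski v v = 0" using nn by simp
    then have "snd v \<bullet> snd v \<le> 0" using * by simp
    then have "snd v = 0" by (metis inner_gt_zero_iff not_le)
    then have "fst v = 0" using xv assms(2) by simp
    with \<open>snd v = 0\<close> that show False by (auto simp: prod_eq_iff)
  qed
qed

lemma hyperbola_geodesic:
  fixes x e :: "'d::finite ambient"
  assumes "minkowski x x = -1" "fst x > 0" "minkowski e e = 1" "minkowski x e = 0"
  shows "geodesic_in (points Hyperbolic) 1
    (\<lambda>t. cosh t *\<^sub>R x + sinh t *\<^sub>R e) (\<lambda>t. cosh t *\<^sub>R e + sinh t *\<^sub>R x)"
  unfolding geodesic_in_def
proof (intro allI conjI)
  fix t :: real
  have "minkowski (cosh t *\<^sub>R x + sinh t *\<^sub>R e) (cosh t *\<^sub>R x + sinh t *\<^sub>R e) = (sinh t)\<^sup>2 - (cosh t)\<^sup>2"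
    using assms minkowski_commute[of e x] by (simp add: minkowski_bilinear power2_eq_square)
  also have "\<dots> = -1" by (simp add: cosh_square_eq)
  finally have 1: "minkowski (cosh t *\<^sub>R x + sinh t *\<^sub>R e) (cosh t *\<^sub>R x + sinh t *\<^sub>R e) = -1" .
  have "\<bar>fst e\<bar> \<le> fst x"
  proof (rule power2_le_imp_le)
    show "\<bar>fst e\<bar>\<^sup>2 \<le> (fst x)\<^sup>2"
      using minkowski_positive_on_tangent(1)[OF assms(1,2,4)] assms(3) by simp
  qed (use assms(2) in simp)
  moreover have "\<bar>sinh t\<bar>\<^sup>2 < (cosh t)\<^sup>2"
    using cosh_square_eq[of t] by simp
  then have "\<bar>sinh t\<bar> < cosh t"
    by (rule power2_less_imp_less) (simp add: cosh_real_nonneg)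
  ultimately have "\<bar>sinh t\<bar> * \<bar>fst e\<bar> < cosh t * fst x"
    using assms(2) by (meson abs_ge_zero le_less_trans mult_left_mono mult_strict_right_mono)
  then have "\<bar>sinh t * fst e\<bar> < cosh t * fst x" by (simp add: abs_mult)
  then have "0 < cosh t * fst x + sinh t * fst e" by linarith
  with 1 show "cosh t *\<^sub>R x + sinh t *\<^sub>R e \<in> points Hyperbolic" by simp
qed (auto intro!: derivative_eq_intros)

lemma geodesic_with_velocity_quadric:
  fixes x v :: "'d::finite ambient"
  assumes M: "M = Hyperbolic \<or> M = Spherical" and x: "x \<in> points M" and v: "metric_form M x v = 0"
  obtains k \<gamma> \<eta> where "geodesic_in (points M) k \<gamma> \<eta>" "\<gamma> 0 = x" "\<eta> 0 = v"
proof (cases "v = 0")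
  case True
  have "geodesic_in (points M) 0 (\<lambda>t. x) (\<lambda>t. 0)"
    using x by (auto simp: geodesic_in_def intro!: derivative_eq_intros)
  with that True show thesis by blast
next
  case False
  show thesis
    using M
  proof
    assume M: "M = Hyperbolic"
    define a where "a = sqrt (minkowski v v)"
    have pos: "minkowski v v > 0"
      using minkowski_positive_on_tangent(2)[of x v] x v M False by simp
    then have a: "a \<noteq> 0" "a * a = minkowski v v" by (auto simp: a_def)
    have "geodesic_in (points M) 1 (\<lambda>t. cosh t *\<^sub>R x + sinh t *\<^sub>R (v /\<^sub>R a))
        (\<lambda>t. cosh t *\<^sub>R (v /\<^sub>R a) + sinh t *\<^sub>R x)"
      unfolding M using x v M a pos by (intro hyperbola_geodesic) (auto simp: minkowski_bilinear field_simps)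
    from geodesic_in_reparametrise[OF this, of a 0] show thesis
      by (rule that) (use a in auto)
  next
    assume M: "M = Spherical"
    have "geodesic_in (points M) (-1) (\<lambda>t. cos t *\<^sub>R x + sin t *\<^sub>R (v /\<^sub>R norm v))
        (\<lambda>t. cos t *\<^sub>R (v /\<^sub>R norm v) - sin t *\<^sub>R x)"
      unfolding M using x v M False
      by (intro great_circle_geodesic) (auto simp: dot_square_norm power2_eq_square)
    from geodesic_in_reparametrise[OF this, of "norm v" 0] show thesis
      by (rule that) (use False in auto)
  qed
qed

text \<open>
  The square of \<open>\<langle>x, y\<rangle>\<close> is compared with \<open>1\<close> through the square of \<open>y - \<langle>x, y\<rangle> x\<close>, the component
  of \<open>y\<close> tangent at \<open>x\<close>. These bounds place the argument of \<open>arccos\<close>, and below that of \<open>arcosh\<close>,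
  where the function has a nonzero derivative.
\<close>

lemma spherical_inner_bounds:
  fixes x y :: "'d::finite ambient"
  assumes "x \<in> points Spherical" "y \<in> points Spherical" "x \<noteq> y" "x \<noteq> - y"
  shows "-1 < x \<bullet> y" "x \<bullet> y < 1" 
proof -
  define c where "c = x \<bullet> y"
  have xy: "x \<bullet> x = 1" "y \<bullet> y = 1" using assms by auto
  have z: "(y - c *\<^sub>R x) \<bullet> (y - c *\<^sub>R x) = 1 - c\<^sup>2"
    using xy by (simp add: c_def inner_simps inner_commute[of y x] power2_eq_square)
  have "y - c *\<^sub>R x \<noteq> 0"
  proof
    assume 0: "y - c *\<^sub>R x = 0"
    then have "c\<^sup>2 = 1" using z by simp
    then have "c = 1 \<or> c = -1" by (simp add: power2_eq_1_iff)
    then show False using 0 assms(3,4) by auto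
  qed
  then have "c\<^sup>2 < 1" using z by (metis inner_gt_zero_iff diff_gt_0_iff_gt)
  then have "\<bar>c\<bar> < 1" by (simp add: abs_square_less_1)
  then show "-1 < x \<bullet> y" "x \<bullet> y < 1" by (auto simp: c_def)
qed

lemma hyperbolic_minkowski_bound:
  assumes "x \<in> points Hyperbolic" "y \<in> points Hyperbolic" "x \<noteq> y"
  shows "minkowski x y < -1"
proof -
  define c where "c = - minkowski x y"
  have xx: "snd x \<bullet> snd x = (fst x)\<^sup>2 - 1" and yy: "snd y \<bullet> snd y = (fst y)\<^sup>2 - 1"
    and x0: "fst x > 0" and y0: "fst y > 0"
    using assms by (auto simp: minkowski_def power2_eq_square)
  have c: "c = fst x * fst y - snd x \<bullet> snd y" by (simp add: c_def minkowski_def)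
  have "(norm (snd x))\<^sup>2 < (fst x)\<^sup>2" "(norm (snd y))\<^sup>2 < (fst y)\<^sup>2"
    using xx yy by (simp_all add: dot_square_norm)
  then have "norm (snd x) < fst x" "norm (snd y) < fst y"
    using x0 y0 by (simp_all add: power2_less_imp_less)
  then have "norm (snd x) * norm (snd y) < fst x * fst y"
    by (intro mult_strict_mono') auto
  then have c0: "c > 0" using norm_cauchy_schwarz[of "snd x" "snd y"] c by linarith
  define z where "z = y - c *\<^sub>R x"
  have m: "minkowski x x = -1" "minkowski y y = -1" using assms by auto
  have zz: "minkowski z z = c\<^sup>2 - 1" and xz: "minkowski x z = 0"
    using m minkowski_commute[of y x] by (auto simp: z_def minkowski_bilinear c_def power2_eq_square)
  have "z \<noteq> 0"
  proof
    assume 0: "z = 0"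
    then have "c\<^sup>2 = 1" using zz by (simp add: minkowski_def)
    then have "c = 1" using c0 by (simp add: power2_eq_1_iff)
    then show False using 0 assms(3) by (simp add: z_def)
  qed
  then have "c\<^sup>2 > 1"
    using minkowski_positive_on_tangent(2)[OF m(1) x0 xz] zz by simp
  then have "c > 1" using c0 by (metis one_power2 power2_less_imp_less less_imp_le)
  then show ?thesis by (simp add: c_def)
qed

text \<open>
  The two end velocities are proportional to \<open>y - c x\<close> and \<open>c y - x\<close>; this symmetry is what later
  turns a quantity conserved along the geodesic into a relation between its end points.
\<close>

lemma geodesic_between_quadric:
  fixes x y :: "'d::finite ambient"
  assumes M: "M = Hyperbolic \<or> M = Spherical" and x: "x \<in> points M" and y: "y \<in> points M"
    and ne: "x \<noteq> y" "M = Spherical \<Longrightarrow> x \<noteq> - y"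
  obtains k \<gamma> \<eta> T s c where "geodesic_in (points M) k \<gamma> \<eta>" "\<gamma> 0 = x" "\<gamma> T = y" "s \<noteq> 0"
    "s *\<^sub>R \<eta> 0 = y - c *\<^sub>R x" "s *\<^sub>R \<eta> T = c *\<^sub>R y - x"
  using M
proof
  assume M: "M = Spherical"
  define c where "c = x \<bullet> y"
  define T where "T = arccos c"
  define e where "e = (y - c *\<^sub>R x) /\<^sub>R sin T"
  have cb: "-1 < c" "c < 1" using spherical_inner_bounds[of x y] x y ne M by (auto simp: c_def)
  then have cT: "cos T = c" by (simp add: T_def)
  have sT: "sin T * sin T = 1 - c * c"
    using sin_cos_squared_add[of T] cT by (simp add: power2_eq_square)
  have s0: "sin T \<noteq> 0" using cb by (simp add: T_def sin_arccos_nonzero)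
  have xy: "x \<bullet> x = 1" "y \<bullet> y = 1" using x y M by auto
  have "(y - c *\<^sub>R x) \<bullet> (y - c *\<^sub>R x) = sin T * sin T"
    using xy sT by (simp add: c_def inner_simps inner_commute[of y x])
  then have ee: "e \<bullet> e = 1" using s0 by (simp add: e_def) (simp add: field_simps)
  have xe: "x \<bullet> e = 0" using xy by (simp add: e_def c_def inner_simps)
  have se: "sin T *\<^sub>R e = y - c *\<^sub>R x" using s0 by (simp add: e_def)
  have "sin T *\<^sub>R (cos T *\<^sub>R e - sin T *\<^sub>R x) = cos T *\<^sub>R (sin T *\<^sub>R e) - (sin T * sin T) *\<^sub>R x"
    by (simp add: scaleR_diff_right mult.commute)
  also have "\<dots> = c *\<^sub>R y - x" by (simp add: se cT sT algebra_simps)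
  finally have end_velocity: "sin T *\<^sub>R (cos T *\<^sub>R e - sin T *\<^sub>R x) = c *\<^sub>R y - x" .
  show thesis
    using great_circle_geodesic[OF xy(1) ee xe] unfolding M[symmetric]
    by (rule that[where T = T and s = "sin T" and c = c]) (use se s0 cT end_velocity in auto)
next
  assume M: "M = Hyperbolic"
  define c where "c = - minkowski x y"
  define T where "T = arcosh c"
  define e where "e = (y - c *\<^sub>R x) /\<^sub>R sinh T"
  have cb: "1 < c" using hyperbolic_minkowski_bound[of x y] x y ne M by (auto simp: c_def)
  then have cT: "cosh T = c" by (simp add: T_def cosh_arcosh_real)
  have sT: "sinh T * sinh T = c * c - 1"
    using cosh_square_eq[of T] cT by (simp add: power2_eq_square)
  have "c * c > 1" using cb by (simp add: less_1_mult)
  then have s0: "sinh T \<noteq> 0" using sT by auto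
  have m: "minkowski x x = -1" "minkowski y y = -1" "fst x > 0" using x y M by auto
  have "minkowski (y - c *\<^sub>R x) (y - c *\<^sub>R x) = sinh T * sinh T"
    using m sT minkowski_commute[of y x] by (simp add: minkowski_bilinear c_def)
  then have "minkowski e e = inverse (sinh T) * (inverse (sinh T) * (sinh T * sinh T))"
    by (simp only: e_def minkowski_bilinear(5,6))
  then have ee: "minkowski e e = 1" using s0 by (simp add: field_simps)
  have xe: "minkowski x e = 0" using m by (simp add: e_def minkowski_bilinear c_def)
  have se: "sinh T *\<^sub>R e = y - c *\<^sub>R x" using s0 by (simp add: e_def)
  have "sinh T *\<^sub>R (cosh T *\<^sub>R e + sinh T *\<^sub>R x) = cosh T *\<^sub>R (sinh T *\<^sub>R e) + (sinh T * sinh T) *\<^sub>R x"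
    by (simp add: scaleR_add_right mult.commute)
  also have "\<dots> = c *\<^sub>R y - x" by (simp add: se cT sT algebra_simps)
  finally have end_velocity: "sinh T *\<^sub>R (cosh T *\<^sub>R e + sinh T *\<^sub>R x) = c *\<^sub>R y - x" .
  show thesis
    using hyperbola_geodesic[OF m(1,3) ee xe] unfolding M[symmetric]
    by (rule that[where T = T and s = "sinh T" and c = c]) (use se s0 cT end_velocity in auto)
qed

text \<open>
  Differentiating the equation of the quadric along a curve gives one inclusion; the geodesic with
  a prescribed initial velocity gives the other.
\<close>

lemma tangent_space_quadric:
  fixes x :: "'d::finite ambient"
  assumes M: "M = Hyperbolic \<or> M = Spherical" and x: "x \<in> points M"
  shows "tangent_space (points M) x = {v. metric_form M x v = 0}"
proof (intro equalityI subsetI CollectI)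
  fix v assume "v \<in> tangent_space (points M) x"
  then obtain e c where e: "e > 0" and c: "c ` {-e<..<e} \<subseteq> points M" "c 0 = x"
    "(c has_vector_derivative v) (at 0)"
    unfolding tangent_space_def by blast
  have "((\<lambda>t. form_op M (c t) \<bullet> c t) has_vector_derivative form_op M x \<bullet> v + form_op M v \<bullet> x) (at 0)"
    using bounded_bilinear.has_vector_derivative[OF bounded_bilinear_inner
        bounded_linear.has_vector_derivative[OF linear_form_op[unfolded linear_conv_bounded_linear] c(3)] c(3)]
      c(2) by simp
  moreover have "((\<lambda>t. form_op M (c t) \<bullet> c t) has_vector_derivative 0) (at 0)"
  proof (rule has_vector_derivative_transform_within_open[of "\<lambda>t. form_op M x \<bullet> x"])
    show "open {-e<..<e}" "0 \<in> {-e<..<e}" using e by auto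
    show "form_op M x \<bullet> x = form_op M (c t) \<bullet> c t" if "t \<in> {-e<..<e}" for t
    proof -
      have "c t \<in> points M" using c(1) that by blast
      then show ?thesis unfolding metric_form_form_op[symmetric] using M x by auto
    qed
  qed simp
  ultimately have "form_op M x \<bullet> v + form_op M v \<bullet> x = 0"
    by (rule vector_derivative_unique_at)
  moreover have "form_op M v \<bullet> x = form_op M x \<bullet> v"
    by (metis metric_form_commute metric_form_form_op)
  ultimately show "metric_form M x v = 0" by (simp add: metric_form_form_op)
next
  fix v assume "v \<in> {v. metric_form M x v = 0}"
  then obtain k \<gamma> \<eta> where "geodesic_in (points M) k \<gamma> \<eta>" "\<gamma> 0 = x" "\<eta> 0 = v"
    using geodesic_with_velocity_quadric[OF M x, of v] by blast
  then show "v \<in> tangent_space (points M) x"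
    using geodesic_velocity_tangent by metis
qed

lemma tangent_space_hyperplane:
  fixes x n :: "'a::euclidean_space"
  assumes "n \<bullet> x = b"
  shows "tangent_space {x. n \<bullet> x = b} x = {v. n \<bullet> v = 0}"
proof (intro equalityI subsetI CollectI)
  fix v assume "v \<in> tangent_space {x. n \<bullet> x = b} x"
  then obtain e c where e: "e > 0" and c: "c ` {-e<..<e} \<subseteq> {x. n \<bullet> x = b}" "c 0 = x"
    "(c has_vector_derivative v) (at 0)"
    unfolding tangent_space_def by blast
  have "((\<lambda>t. n \<bullet> c t) has_vector_derivative n \<bullet> v) (at 0)"
    using bounded_linear.has_vector_derivative[OF bounded_linear_inner_right c(3)] .
  moreover have "((\<lambda>t. n \<bullet> c t) has_vector_derivative 0) (at 0)"
    by (rule has_vector_derivative_transform_within_open[of "\<lambda>t. b" _ _ "{-e<..<e}"])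
      (use e c(1) in \<open>auto simp: image_subset_iff\<close>)
  ultimately show "n \<bullet> v = 0"
    by (rule vector_derivative_unique_at)
next
  fix v assume "v \<in> {v. n \<bullet> v = 0}"
  then have "geodesic_in {x. n \<bullet> x = b} 0 (\<lambda>t. x + t *\<^sub>R v) (\<lambda>t. v)"
    using assms by (intro line_geodesic) auto
  from geodesic_velocity_tangent[OF this, of 0] show "v \<in> tangent_space {x. n \<bullet> x = b} x"
    by simp
qed

section \<open>Infinitesimal isometric deformations as solutions of linear equations\<close>

text \<open>
  Up to a nonzero factor this is the rate of change of the distance between \<open>x\<close> and \<open>y\<close> when they
  move with velocities \<open>u\<close> and \<open>v\<close>.
\<close>

fun edge_rate ::
    "'d::finite geometry \<Rightarrow> 'd ambient \<Rightarrow> 'd ambient \<Rightarrow> 'd ambient \<Rightarrow> 'd ambient \<Rightarrow> real" where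
  "edge_rate (Euclidean A) x y u v = (x - y) \<bullet> (u - v)"
| "edge_rate M x y u v = metric_form M u y + metric_form M x v"

lemma zero_derivative_comp_iff:
  fixes g \<phi> :: "real \<Rightarrow> real"
  assumes "(g has_real_derivative D) (at t)" "(\<phi> has_real_derivative m) (at (g t))" "m \<noteq> 0"
  shows "((\<lambda>s. \<phi> (g s)) has_real_derivative 0) (at t) \<longleftrightarrow> D = 0"
proof -
  have "((\<lambda>s. \<phi> (g s)) has_real_derivative m * D) (at t)"
    using DERIV_chain2[OF assms(2,1)] .
  then show ?thesis using DERIV_unique assms(3) by (metis mult_eq_0_iff)
qed

text \<open>
  Each distance is a function of a product (\<open>arccos\<close>, \<open>arcosh\<close> of the negative, \<open>sqrt\<close> of the squared
  difference) whose derivative does not vanish at the value taken by an edge, so that the distance is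
  stationary exactly when the product is.
\<close>

lemma geo_dist_derivative_zero_iff:
  fixes x y :: "real \<Rightarrow> 'd::finite ambient"
  assumes x: "(x has_vector_derivative u) (at 0)" "x 0 \<in> points M"
    and y: "(y has_vector_derivative v) (at 0)" "y 0 \<in> points M"
    and ne: "x 0 \<noteq> y 0" "M = Spherical \<Longrightarrow> x 0 \<noteq> - y 0"
  shows "((\<lambda>t. geo_dist M (x t) (y t)) has_real_derivative 0) (at 0) \<longleftrightarrow>
    edge_rate M (x 0) (y 0) u v = 0"
proof -
  have mf: "((\<lambda>t. metric_form M (x t) (y t)) has_real_derivative
      metric_form M u (y 0) + metric_form M (x 0) v) (at 0)"
    unfolding metric_form_form_op has_real_derivative_iff_has_vector_derivative
    using bounded_bilinear.has_vector_derivative[OF bounded_bilinear_inner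
        bounded_linear.has_vector_derivative[OF linear_form_op[unfolded linear_conv_bounded_linear] x(1)] y(1)]
    by (simp add: add.commute)
  show ?thesis
  proof (cases M)
    case Spherical
    then have b: "-1 < x 0 \<bullet> y 0" "x 0 \<bullet> y 0 < 1"
      using spherical_inner_bounds[of "x 0" "y 0"] x y ne by auto
    then have "(x 0 \<bullet> y 0)\<^sup>2 < 1" using abs_square_less_1[of "x 0 \<bullet> y 0"] by auto
    then show ?thesis
      using zero_derivative_comp_iff[OF mf, of arccos, OF _ ] DERIV_arccos[of "x 0 \<bullet> y 0"] b Spherical
      by simp
  next
    case Hyperbolic
    then have b: "minkowski (x 0) (y 0) < -1"
      using hyperbolic_minkowski_bound[of "x 0" "y 0"] x y ne by auto
    then have "1 * 1 < (- minkowski (x 0) (y 0)) * (- minkowski (x 0) (y 0))"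
      by (intro mult_strict_mono) auto
    then have "(minkowski (x 0) (y 0))\<^sup>2 > 1" by (simp add: power2_eq_square)
    then have nz: "1 / sqrt ((- minkowski (x 0) (y 0))\<^sup>2 - 1) \<noteq> 0" by simp
    have "(arcosh has_real_derivative 1 / sqrt ((- minkowski (x 0) (y 0))\<^sup>2 - 1))
        (at (- metric_form M (x 0) (y 0)))"
      using arcosh_real_has_field_derivative[of "- minkowski (x 0) (y 0)"] b Hyperbolic by simp
    then have "((\<lambda>t. arcosh (- metric_form M (x t) (y t))) has_real_derivative 0) (at 0) \<longleftrightarrow>
        - (metric_form M u (y 0) + metric_form M (x 0) v) = 0"
      by (rule zero_derivative_comp_iff[OF DERIV_minus[OF mf] _ nz])
    then show ?thesis using Hyperbolic by (simp add: neg_eq_iff_add_eq_0)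
  next
    case (Euclidean A)
    have d: "((\<lambda>t. x t - y t) has_vector_derivative u - v) (at 0)"
      using x y by (intro has_vector_derivative_diff)
    have "((\<lambda>t. (x t - y t) \<bullet> (x t - y t)) has_real_derivative 2 * ((x 0 - y 0) \<bullet> (u - v))) (at 0)"
      unfolding has_real_derivative_iff_has_vector_derivative
      using bounded_bilinear.has_vector_derivative[OF bounded_bilinear_inner d d]
      by (simp add: inner_commute)
    moreover have pos: "(x 0 - y 0) \<bullet> (x 0 - y 0) > 0" using ne by simp
    note DERIV_real_sqrt[OF pos]
    ultimately have "((\<lambda>t. sqrt ((x t - y t) \<bullet> (x t - y t))) has_real_derivative 0) (at 0) \<longleftrightarrow>
        2 * ((x 0 - y 0) \<bullet> (u - v)) = 0"
      by (rule zero_derivative_comp_iff) (use ne in auto)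
    then show ?thesis
      using Euclidean by (simp add: dist_norm norm_eq_sqrt_inner)
  qed
qed

text \<open>
  A framework whose vertices move along geodesics remains a framework for a short time, because
  the conditions on the edges are open.
\<close>

lemma framework_moves_along_geodesics:
  fixes p q :: "'d::finite ambient ^ 'v::finite"
  assumes fw: "framework M E p"
    and g: "\<And>i. geodesic_in (points M) (k i) (\<gamma> i) (\<eta> i)" "\<And>i. \<gamma> i 0 = p $ i" "\<And>i. \<eta> i 0 = q $ i"
  obtains e c where "e > 0" "smooth_on {-e<..<e} c" "\<And>t. t \<in> {-e<..<e} \<Longrightarrow> framework M E (c t)"
    "c 0 = p" "(c has_vector_derivative q) (at 0)"
proof -
  define c where "c t = (\<chi> i. \<gamma> i t)" for t
  have cont: "continuous_on UNIV (\<gamma> i)" for i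
    using g(1)[of i] unfolding geodesic_in_def
    by (meson continuous_at_imp_continuous_on has_vector_derivative_continuous)
  define U where "U = (\<Inter>i. \<Inter>j. {t. {i, j} \<in> E \<longrightarrow> \<gamma> i t \<noteq> \<gamma> j t \<and> (M = Spherical \<longrightarrow> \<gamma> i t \<noteq> - \<gamma> j t)})"
  have "open U"
    unfolding U_def
  proof (intro open_INT ballI finite)
    fix i j
    have "open {t. \<gamma> i t \<noteq> \<gamma> j t}" "open {t. \<gamma> i t \<noteq> - \<gamma> j t}"
      using cont by (auto intro!: open_Collect_neq continuous_intros)
    then have "open ({t. \<gamma> i t \<noteq> \<gamma> j t} \<inter> {t. \<gamma> i t \<noteq> - \<gamma> j t})" "open {t. \<gamma> i t \<noteq> \<gamma> j t}" by auto
    then show "open {t. {i, j} \<in> E \<longrightarrow> \<gamma> i t \<noteq> \<gamma> j t \<and> (M = Spherical \<longrightarrow> \<gamma> i t \<noteq> - \<gamma> j t)}"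
      by (cases "{i, j} \<in> E"; cases "M = Spherical") (auto simp: Collect_conj_eq)
  qed
  moreover have "0 \<in> U" using fw g(2) by (auto simp: U_def framework_def)
  ultimately obtain e where e: "e > 0" "ball 0 e \<subseteq> U" by (meson openE)
  show thesis
  proof
    show "e > 0" by fact
    show "smooth_on {-e<..<e} c"
      unfolding c_def by (rule smooth_on_geodesics[OF g(1)]) auto
    show "framework M E (c t)" if "t \<in> {-e<..<e}" for t
    proof -
      have "t \<in> U" using that e(2) by (auto simp: subset_iff dist_real_def)
      then show ?thesis using g(1) by (auto simp: U_def framework_def c_def geodesic_in_def)
    qed
    show "c 0 = p" using g(2) by (simp add: c_def vec_eq_iff)
    have "((\<lambda>t. \<chi> i. \<gamma> i t) has_vector_derivative (\<chi> i. \<eta> i 0)) (at 0)"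
      using g(1) by (intro has_vector_derivative_vec_lambda) (auto simp: geodesic_in_def)
    then show "(c has_vector_derivative q) (at 0)"
      using g(3) by (simp add: c_def[abs_def])
  qed
qed

text \<open>
  Necessity is the chain rule. For sufficiency the family required by the definition is
  obtained by letting every vertex run along the geodesic with the given velocity.
\<close>

lemma isometric_deformation_iff:
  fixes p q :: "'d::finite ambient ^ 'v::finite"
  assumes fw: "framework M E p"
    and geod: "\<And>x v. x \<in> points M \<Longrightarrow> v \<in> tangent_space (points M) x \<Longrightarrow>
      \<exists>k \<gamma> \<eta>. geodesic_in (points M) k \<gamma> \<eta> \<and> \<gamma> 0 = x \<and> \<eta> 0 = v"
  shows "isometric_deformation M E p q \<longleftrightarrow> vector_field_on M p q \<and>
    (\<forall>i j. {i, j} \<in> E \<longrightarrow> edge_rate M (p $ i) (p $ j) (q $ i) (q $ j) = 0)"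
proof -
  have rate: "((\<lambda>t. geo_dist M (c t $ i) (c t $ j)) has_real_derivative 0) (at 0) \<longleftrightarrow>
      edge_rate M (p $ i) (p $ j) (q $ i) (q $ j) = 0"
    if "c 0 = p" "(c has_vector_derivative q) (at 0)" "{i, j} \<in> E" for c i j
    using geo_dist_derivative_zero_iff[OF has_vector_derivative_vec_nth[OF that(2), of i] _
        has_vector_derivative_vec_nth[OF that(2), of j], of M] fw that(1,3)
    by (auto simp: framework_def)
  show ?thesis
  proof
    assume "isometric_deformation M E p q"
    then show "vector_field_on M p q \<and>
        (\<forall>i j. {i, j} \<in> E \<longrightarrow> edge_rate M (p $ i) (p $ j) (q $ i) (q $ j) = 0)"
      unfolding isometric_deformation_def using rate by blast
  next
    assume q: "vector_field_on M p q \<and>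
        (\<forall>i j. {i, j} \<in> E \<longrightarrow> edge_rate M (p $ i) (p $ j) (q $ i) (q $ j) = 0)"
    then have "\<forall>i. \<exists>k \<gamma> \<eta>. geodesic_in (points M) k \<gamma> \<eta> \<and> \<gamma> 0 = p $ i \<and> \<eta> 0 = q $ i"
      using fw by (intro allI geod) (auto simp: framework_def vector_field_on_def)
    then obtain k \<gamma> \<eta> where g: "\<And>i. geodesic_in (points M) (k i) (\<gamma> i) (\<eta> i)"
      "\<And>i. \<gamma> i 0 = p $ i" "\<And>i. \<eta> i 0 = q $ i" by metis
    obtain e c where "e > 0" "smooth_on {-e<..<e} c" "\<And>t. t \<in> {-e<..<e} \<Longrightarrow> framework M E (c t)"
      "c 0 = p" "(c has_vector_derivative q) (at 0)"
      using framework_moves_along_geodesics[OF fw, of k \<gamma> \<eta> q] g by blast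
    then show "isometric_deformation M E p q"
      unfolding isometric_deformation_def using q rate by blast
  qed
qed

lemma mem_deformations_quadric:
  fixes p q :: "'d::finite ambient ^ 'v::finite"
  assumes M: "M = Hyperbolic \<or> M = Spherical" and fw: "framework M E p"
  shows "q \<in> deformations M E p \<longleftrightarrow> (\<forall>i. form_op M (q $ i) \<bullet> p $ i = 0) \<and>
    (\<forall>i j. {i, j} \<in> E \<longrightarrow> form_op M (q $ i) \<bullet> p $ j + form_op M (q $ j) \<bullet> p $ i = 0)"
proof -
  have "\<exists>k \<gamma> \<eta>. geodesic_in (points M) k \<gamma> \<eta> \<and> \<gamma> 0 = x \<and> \<eta> 0 = v"
    if "x \<in> points M" "v \<in> tangent_space (points M) x" for x v
    using geodesic_with_velocity_quadric[OF M that(1), of v] that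
    unfolding tangent_space_quadric[OF M that(1)] by blast
  moreover have "metric_form M x v = form_op M v \<bullet> x" for x v :: "'d ambient"
    by (metis metric_form_commute metric_form_form_op)
  moreover have "edge_rate M x y u v = form_op M u \<bullet> y + form_op M v \<bullet> x" for x y u v
  proof -
    have "edge_rate M x y u v = metric_form M u y + metric_form M x v" using M by auto
    then show ?thesis by (metis metric_form_commute metric_form_form_op)
  qed
  moreover have "p $ i \<in> points M" for i using fw by (simp add: framework_def)
  ultimately show ?thesis
    unfolding deformations_def mem_Collect_eq using isometric_deformation_iff[OF fw, of q]
    by (simp add: vector_field_on_def tangent_space_quadric[OF M])
qed

lemma mem_deformations_hyperplane:
  fixes p q :: "'d::finite ambient ^ 'v::finite"
  assumes fw: "framework (Euclidean {x. n \<bullet> x = b}) E p"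
  shows "q \<in> deformations (Euclidean {x. n \<bullet> x = b}) E p \<longleftrightarrow> (\<forall>i. n \<bullet> q $ i = 0) \<and>
    (\<forall>i j. {i, j} \<in> E \<longrightarrow> (p $ i - p $ j) \<bullet> (q $ i - q $ j) = 0)"
proof -
  have "\<exists>k \<gamma> \<eta>. geodesic_in {x. n \<bullet> x = b} k \<gamma> \<eta> \<and> \<gamma> 0 = x \<and> \<eta> 0 = v"
    if "n \<bullet> x = b" "v \<in> tangent_space {x. n \<bullet> x = b} x" for x v
  proof -
    have "geodesic_in {x. n \<bullet> x = b} 0 (\<lambda>t. x + t *\<^sub>R v) (\<lambda>t. v)"
      using that tangent_space_hyperplane[OF that(1)] by (intro line_geodesic) auto
    moreover have "x + 0 *\<^sub>R v = x" by simp
    ultimately show ?thesis by blast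
  qed
  moreover have "n \<bullet> p $ i = b" for i using fw by (simp add: framework_def)
  ultimately show ?thesis
    unfolding deformations_def mem_Collect_eq using isometric_deformation_iff[OF fw, of q]
    by (simp add: vector_field_on_def tangent_space_hyperplane)
qed

section \<open>Killing fields are linear\<close>

text \<open>
  Along a geodesic the Killing equation kills the derivative of \<open>K\<close> paired with the velocity,
  and the remaining term \<open>k \<langle>K, \<gamma>\<rangle>\<close> vanishes because \<open>K\<close> is tangent (or because \<open>k = 0\<close>).
\<close>

lemma killing_field_conserved_along_geodesic:
  fixes K :: "'d::finite ambient \<Rightarrow> 'd ambient"
  assumes K: "killing_field M K" and g: "geodesic_in (points M) k \<gamma> \<eta>"
    and normal: "\<And>t. k * metric_form M (K (\<gamma> t)) (\<gamma> t) = 0"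
  shows "metric_form M (K (\<gamma> a)) (\<eta> a) = metric_form M (K (\<gamma> b)) (\<eta> b)"
proof -
  have "((\<lambda>t. metric_form M (K (\<gamma> t)) (\<eta> t)) has_real_derivative 0) (at t)" for t
  proof -
    let ?D = "frechet_derivative K (at (\<gamma> t))"
    have mem: "\<gamma> t \<in> points M" and g1: "(\<gamma> has_vector_derivative \<eta> t) (at t)"
      and g2: "(\<eta> has_vector_derivative k *\<^sub>R \<gamma> t) (at t)"
      using g by (auto simp: geodesic_in_def)
    obtain U where U: "points M \<subseteq> U" "smooth_on U K" using K by (auto simp: killing_field_def)
    then have "Ck_on (Suc 0) U K" by (simp add: smooth_on_def)
    then have "K differentiable (at (\<gamma> t))" using U(1) mem by auto
    then have D: "(K has_derivative ?D) (at (\<gamma> t))" by (simp add: frechet_derivative_works)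
    have lin: "?D (h *\<^sub>R u) = h *\<^sub>R ?D u" for h u
      using has_derivative_bounded_linear[OF D] by (simp add: bounded_linear.linear linear_cmul)
    have 1: "((\<lambda>t. K (\<gamma> t)) has_vector_derivative ?D (\<eta> t)) (at t)"
      using has_derivative_compose[OF g1[unfolded has_vector_derivative_def], of K ?D] D
      by (simp add: has_vector_derivative_def lin)
    have "((\<lambda>t. form_op M (K (\<gamma> t)) \<bullet> \<eta> t) has_vector_derivative
        form_op M (K (\<gamma> t)) \<bullet> (k *\<^sub>R \<gamma> t) + form_op M (?D (\<eta> t)) \<bullet> \<eta> t) (at t)"
      using bounded_bilinear.has_vector_derivative[OF bounded_bilinear_inner
        bounded_linear.has_vector_derivative[OF linear_form_op[unfolded linear_conv_bounded_linear] 1] g2] .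
    moreover have "\<eta> t \<in> tangent_space (points M) (\<gamma> t)"
      by (rule geodesic_velocity_tangent[OF g])
    then have "metric_form M (?D (\<eta> t)) (\<eta> t) + metric_form M (\<eta> t) (?D (\<eta> t)) = 0"
      using K mem unfolding killing_field_def by blast
    then have "metric_form M (?D (\<eta> t)) (\<eta> t) = 0" by (simp add: metric_form_commute)
    ultimately show ?thesis
      using normal[of t]
      by (auto simp: has_real_derivative_iff_has_vector_derivative metric_form_form_op)
  qed
  then show ?thesis by (intro DERIV_isconst_all) auto
qed

text \<open>
  The conserved quantity is compared at the two ends of a geodesic from \<open>x\<close> to \<open>y\<close>, where tangency
  of \<open>K\<close> removes the multiples of \<open>x\<close> and \<open>y\<close> from the velocities. Equal or antipodal points need no
  geodesic: tangency alone makes both terms vanish.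
\<close>

lemma killing_field_pair_quadric:
  fixes K :: "'d::finite ambient \<Rightarrow> 'd ambient"
  assumes M: "M = Hyperbolic \<or> M = Spherical" and K: "killing_field M K"
    and x: "x \<in> points M" and y: "y \<in> points M"
  shows "metric_form M (K x) y + metric_form M x (K y) = 0"
proof -
  have tan: "metric_form M z (K z) = 0" "metric_form M (K z) z = 0" if "z \<in> points M" for z
    using K that metric_form_commute[of M z "K z"] tangent_space_quadric[OF M that]
    by (auto simp: killing_field_def)
  have neg: "metric_form M (u :: 'd ambient) (- v) = - metric_form M u v"
    "metric_form M (- v) u = - metric_form M v u" for u v
    by (simp_all add: metric_form_form_op form_op_inner_commute)
  consider "x = y" | "x = - y" | "x \<noteq> y" "x \<noteq> - y" by blast
  then show ?thesis
  proof cases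
    case 1
    then show ?thesis using tan x by simp
  next
    case 2
    then have "metric_form M (K x) y = - metric_form M (K x) x" "metric_form M x (K y) = - metric_form M y (K y)"
      by (simp_all add: neg)
    then show ?thesis using tan x y by simp
  next
    case 3
    obtain k \<gamma> \<eta> T s c where g: "geodesic_in (points M) k \<gamma> \<eta>" "\<gamma> 0 = x" "\<gamma> T = y" and s: "s \<noteq> 0"
      and v: "s *\<^sub>R \<eta> 0 = y - c *\<^sub>R x" "s *\<^sub>R \<eta> T = c *\<^sub>R y - x"
      using geodesic_between_quadric[OF M x y 3(1)] 3(2) by metis
    have "metric_form M (K (\<gamma> 0)) (\<eta> 0) = metric_form M (K (\<gamma> T)) (\<eta> T)"
      by (rule killing_field_conserved_along_geodesic[OF K g(1)])
        (use g(1) tan in \<open>auto simp: geodesic_in_def\<close>)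
    then have "form_op M (K x) \<bullet> (s *\<^sub>R \<eta> 0) = form_op M (K y) \<bullet> (s *\<^sub>R \<eta> T)"
      using g by (simp add: metric_form_form_op)
    then have "form_op M (K x) \<bullet> y = - (form_op M (K y) \<bullet> x)"
      using tan(2)[OF x] tan(2)[OF y]
      by (simp add: v metric_form_form_op inner_diff_right)
    then show ?thesis
      using metric_form_commute[of M x "K y"] by (simp add: metric_form_form_op)
  qed
qed

lemma killing_field_pair_hyperplane:
  fixes K :: "'d::finite ambient \<Rightarrow> 'd ambient"
  assumes K: "killing_field (Euclidean {x. n \<bullet> x = b}) K" and x: "n \<bullet> x = b" and y: "n \<bullet> y = b"
  shows "(K x - K y) \<bullet> (x - y) = 0"
proof -
  have "geodesic_in {x. n \<bullet> x = b} 0 (\<lambda>t. x + t *\<^sub>R (y - x)) (\<lambda>t. y - x)"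
    using x y by (intro line_geodesic) (auto simp: inner_diff_right)
  then have "geodesic_in (points (Euclidean {x. n \<bullet> x = b})) 0 (\<lambda>t. x + t *\<^sub>R (y - x)) (\<lambda>t. y - x)"
    by simp
  from killing_field_conserved_along_geodesic[OF K this, of 0 1] show ?thesis
    by (simp add: inner_diff_left inner_diff_right)
qed

text \<open>
  Pairing with the members of a basis contained in \<open>S\<close> determines \<open>f\<close> from its values on that basis,
  so that \<open>f\<close> agrees with the linear map that has the same values there.
\<close>

lemma skew_on_spanning_set_is_linear:
  fixes f :: "'a::euclidean_space \<Rightarrow> 'a"
  assumes S: "span S = UNIV" and f: "\<And>x y. x \<in> S \<Longrightarrow> y \<in> S \<Longrightarrow> f x \<bullet> y + f y \<bullet> x = 0"
  obtains B where "linear B" "\<And>x y. B x \<bullet> y + B y \<bullet> x = 0" "\<And>x. x \<in> S \<Longrightarrow> f x = B x"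
proof -
  obtain b where b: "b \<subseteq> S" "independent b" "S \<subseteq> span b"
    using maximal_independent_subset[of S] by blast
  then have spanb: "span b = UNIV" using S by (metis span_mono span_span top.extremum_uniqueI)
  obtain B where B: "linear B" "\<And>x. x \<in> b \<Longrightarrow> B x = f x"
    using linear_independent_extend[OF b(2), of f] by blast
  have half: "B x \<bullet> y + B y \<bullet> x = 0" if y: "y \<in> b" for x y
  proof -
    have "x \<in> span b" using spanb by simp
    then show ?thesis
    proof (induction rule: span_induct)
      case base
      show ?case
        by (auto simp: subspace_def linear_0[OF B(1)] linear_add[OF B(1)] linear_cmul[OF B(1)]
            inner_add_left inner_add_right distrib_left[symmetric] simp flip: add.assoc)
    next
      case (step x)
      then show ?case using f b(1) y B(2) by (metis subsetD)
    qed
  qed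
  have skew: "B x \<bullet> y + B y \<bullet> x = 0" for x y
  proof -
    have "y \<in> span b" using spanb by simp
    then show ?thesis
    proof (induction rule: span_induct)
      case base
      show ?case
        by (auto simp: subspace_def linear_0[OF B(1)] linear_add[OF B(1)] linear_cmul[OF B(1)]
            inner_add_left inner_add_right distrib_left[symmetric] simp flip: add.assoc)
    next
      case (step y)
      then show ?case using half by simp
    qed
  qed
  have "f x = B x" if x: "x \<in> S" for x
  proof -
    have "(f x - B x) \<bullet> y = 0" if "y \<in> b" for y
    proof -
      have "f x \<bullet> y + B y \<bullet> x = 0" using f[OF x, of y] b(1) B(2) that by auto
      then show ?thesis using skew[of x y] by (simp add: inner_diff_left)
    qed
    then have "(f x - B x) \<bullet> (f x - B x) = 0"
    proof -
      have "f x - B x \<in> span b" using spanb by simp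
      then have "\<forall>y\<in>span b. (f x - B x) \<bullet> y = 0"
        using \<open>\<And>y. y \<in> b \<Longrightarrow> (f x - B x) \<bullet> y = 0\<close>
        by (metis orthogonal_def orthogonal_to_span)
      then show ?thesis using spanb by blast
    qed
    then show ?thesis by simp
  qed
  with B(1) skew that show thesis by blast
qed

lemma span_quadric:
  assumes M: "M = Hyperbolic \<or> M = Spherical"
  shows "span (points (M :: 'd::finite geometry)) = UNIV"
  using M
proof
  assume M: "M = Spherical"
  have "x \<in> span (points M)" for x :: "'d ambient"
  proof (cases "x = 0")
    case False
    then have "x /\<^sub>R norm x \<in> points M" by (simp add: M dot_square_norm power2_eq_square)
    then have "norm x *\<^sub>R (x /\<^sub>R norm x) \<in> span (points M)" by (intro span_scale span_base)
    then show ?thesis using False by simp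
  qed (simp add: span_zero)
  then show ?thesis by auto
next
  assume M: "M = Hyperbolic"
  have e0: "(1, 0) \<in> points M" by (simp add: M minkowski_def)
  have "(a, w) \<in> span (points M)" for a :: real and w :: "real ^ 'd"
  proof -
    let ?r = "sqrt (1 + w \<bullet> w)"
    have "0 < 1 + w \<bullet> w" by (simp add: add_pos_nonneg)
    then have "(?r, w) \<in> points M" by (simp add: M minkowski_def)
    then have "(?r, w) + (a - ?r) *\<^sub>R (1, 0) \<in> span (points M)"
      using e0 by (intro span_add span_scale span_base)
    then show ?thesis by simp
  qed
  then show ?thesis by auto
qed

lemma span_hyperplane:
  fixes n :: "'a::euclidean_space"
  assumes n: "n \<noteq> 0"
  shows "span {x. n \<bullet> x = 1} = UNIV"
proof -
  have A: "x \<in> span {x. n \<bullet> x = 1}" if "n \<bullet> x \<noteq> 0" for x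
  proof -
    have "(n \<bullet> x) *\<^sub>R (x /\<^sub>R (n \<bullet> x)) \<in> span {x. n \<bullet> x = 1}"
      using that by (intro span_scale span_base) simp
    then show ?thesis using that by simp
  qed
  have "x \<in> span {x. n \<bullet> x = 1}" for x
  proof (cases "n \<bullet> x = 0")
    case True
    then have "(x + n) - n \<in> span {x. n \<bullet> x = 1}"
      using n by (intro span_diff A) (auto simp: inner_add_right)
    then show ?thesis by simp
  qed (rule A)
  then show ?thesis by auto
qed

lemma frechet_derivative_linear:
  fixes f :: "'a::euclidean_space \<Rightarrow> 'b::real_normed_vector"
  assumes "linear f"
  shows "frechet_derivative f (at x) = f"
  by (rule frechet_derivative_at[symmetric], rule bounded_linear_imp_has_derivative)
    (use assms in \<open>simp add: linear_conv_bounded_linear\<close>)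

text \<open>
  The relation between all pairs of points says that \<open>J K\<close> is skew for the Euclidean product. Because
  the points span the ambient space, it is the restriction of a skew linear map \<open>B\<close>. On the sphere
  this is what determines a Killing field on one open hemisphere from its values on the other, which
  is essential when the vertices lie in both.
\<close>

lemma killing_field_values_quadric:
  fixes p q :: "'d::finite ambient ^ 'v::finite"
  assumes M: "M = Hyperbolic \<or> M = Spherical" and p: "\<And>i. p $ i \<in> points M"
  shows "(\<exists>K. killing_field M K \<and> (\<forall>i. q $ i = K (p $ i))) \<longleftrightarrow>
    (\<exists>B. linear B \<and> (\<forall>x y. B x \<bullet> y + B y \<bullet> x = 0) \<and> (\<forall>i. form_op M (q $ i) = B (p $ i)))"
proof
  assume "\<exists>K. killing_field M K \<and> (\<forall>i. q $ i = K (p $ i))"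
  then obtain K where K: "killing_field M K" "\<And>i. q $ i = K (p $ i)" by blast
  obtain B where "linear B" "\<And>x y. B x \<bullet> y + B y \<bullet> x = 0" "\<And>x. x \<in> points M \<Longrightarrow> form_op M (K x) = B x"
  proof (rule skew_on_spanning_set_is_linear[OF span_quadric[OF M], of "\<lambda>x. form_op M (K x)"])
    fix x y assume "x \<in> points M" "y \<in> points M"
    from killing_field_pair_quadric[OF M K(1) this]
    show "form_op M (K x) \<bullet> y + form_op M (K y) \<bullet> x = 0"
      by (metis metric_form_commute metric_form_form_op)
  qed blast
  then show "\<exists>B. linear B \<and> (\<forall>x y. B x \<bullet> y + B y \<bullet> x = 0) \<and> (\<forall>i. form_op M (q $ i) = B (p $ i))"
    using K(2) p by metis
next
  assume "\<exists>B. linear B \<and> (\<forall>x y. B x \<bullet> y + B y \<bullet> x = 0) \<and> (\<forall>i. form_op M (q $ i) = B (p $ i))"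
  then obtain B where B: "linear B" "\<And>x y. B x \<bullet> y + B y \<bullet> x = 0" "\<And>i. form_op M (q $ i) = B (p $ i)"
    by blast
  define K where "K x = form_op M (B x)" for x
  have lin: "linear K"
    unfolding K_def using linear_compose[OF B(1) linear_form_op] by (simp add: o_def)
  have mK: "metric_form M (K x) y = B x \<bullet> y" "metric_form M y (K x) = B x \<bullet> y" for x y
    by (metis K_def form_op_form_op metric_form_commute metric_form_form_op)+
  have "killing_field M K"
    unfolding killing_field_def frechet_derivative_linear[OF lin]
  proof (intro conjI ballI)
    show "\<exists>U. open U \<and> points M \<subseteq> U \<and> smooth_on U K"
      using smooth_on_linear[OF lin, of UNIV] by blast
    show "K x \<in> tangent_space (points M) x" if "x \<in> points M" for x
      using B(2)[of x x] by (simp add: tangent_space_quadric[OF M that] mK)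
  qed (use B(2) in \<open>simp add: mK\<close>)
  moreover have "q $ i = K (p $ i)" for i
    by (metis K_def B(3) form_op_form_op)
  ultimately show "\<exists>K. killing_field M K \<and> (\<forall>i. q $ i = K (p $ i))" by blast
qed

definition proj_along :: "'a::euclidean_space \<Rightarrow> 'a \<Rightarrow> 'a" where
  "proj_along n x = x - ((n \<bullet> x) / (n \<bullet> n)) *\<^sub>R n"

lemma linear_proj_along: "linear (proj_along n)"
  by (intro linearI) (auto simp: proj_along_def inner_add_right add_divide_distrib algebra_simps)

lemma inner_proj_along: "n \<noteq> 0 \<Longrightarrow> n \<bullet> proj_along n x = 0"
  by (simp add: proj_along_def inner_diff_right)

lemma proj_along_inner_tangent: "n \<bullet> v = 0 \<Longrightarrow> proj_along n x \<bullet> v = x \<bullet> v"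
  by (simp add: proj_along_def inner_diff_left)

lemma proj_along_add_normal:
  "n \<noteq> 0 \<Longrightarrow> n \<bullet> v = 0 \<Longrightarrow> proj_along n (v - a *\<^sub>R n) = v"
  by (simp add: proj_along_def inner_diff_right)

text \<open>
  A Killing field on a hyperplane not through the origin comes from a skew linear map of the whole
  ambient space too: translations arise from the maps that rotate the normal direction. This makes
  the trivial deformations of the two geometries correspond to the same maps \<open>B\<close>.
\<close>

lemma killing_field_values_hyperplane:
  fixes p q :: "'d::finite ambient ^ 'v::finite"
  assumes n: "n \<noteq> 0" and p: "\<And>i. n \<bullet> p $ i = 1"
  shows "(\<exists>K. killing_field (Euclidean {x. n \<bullet> x = 1}) K \<and> (\<forall>i. q $ i = K (p $ i))) \<longleftrightarrow>
    (\<exists>B. linear B \<and> (\<forall>x y. B x \<bullet> y + B y \<bullet> x = 0) \<and> (\<forall>i. q $ i = proj_along n (B (p $ i))))"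
proof
  assume "\<exists>K. killing_field (Euclidean {x. n \<bullet> x = 1}) K \<and> (\<forall>i. q $ i = K (p $ i))"
  then obtain K where K: "killing_field (Euclidean {x. n \<bullet> x = 1}) K" "\<And>i. q $ i = K (p $ i)" by blast
  have tan: "n \<bullet> K x = 0" if "n \<bullet> x = 1" for x
  proof -
    have "K x \<in> tangent_space {x. n \<bullet> x = 1} x"
      using K(1) that unfolding killing_field_def points.simps by blast
    then show ?thesis using tangent_space_hyperplane[OF that] by blast
  qed
  \<comment> \<open>The normal component is chosen to make the field at \<open>x\<close> orthogonal to \<open>x\<close>.\<close>
  define f where "f x = K x - (x \<bullet> K x) *\<^sub>R n" for x
  obtain B where B: "linear B" "\<And>x y. B x \<bullet> y + B y \<bullet> x = 0" "\<And>x. x \<in> {x. n \<bullet> x = 1} \<Longrightarrow> f x = B x"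
  proof (rule skew_on_spanning_set_is_linear[OF span_hyperplane[OF n], of f])
    fix x y assume "x \<in> {x. n \<bullet> x = 1}" "y \<in> {x. n \<bullet> x = 1}"
    then have "n \<bullet> x = 1" "n \<bullet> y = 1" by auto
    then show "f x \<bullet> y + f y \<bullet> x = 0"
      using killing_field_pair_hyperplane[OF K(1), of x y]
      by (simp add: f_def inner_diff_left inner_diff_right inner_commute)
  qed blast
  have "q $ i = proj_along n (B (p $ i))" for i
    using proj_along_add_normal[OF n tan[OF p]] B(3)[of "p $ i"] p K(2) by (simp add: f_def flip: B(3))
  with B show "\<exists>B. linear B \<and> (\<forall>x y. B x \<bullet> y + B y \<bullet> x = 0) \<and> (\<forall>i. q $ i = proj_along n (B (p $ i)))"
    by blast
next
  assume "\<exists>B. linear B \<and> (\<forall>x y. B x \<bullet> y + B y \<bullet> x = 0) \<and> (\<forall>i. q $ i = proj_along n (B (p $ i)))"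
  then obtain B where B: "linear B" "\<And>x y. B x \<bullet> y + B y \<bullet> x = 0"
    "\<And>i. q $ i = proj_along n (B (p $ i))" by blast
  define K where "K x = proj_along n (B x)" for x
  have lin: "linear K"
    unfolding K_def using linear_compose[OF B(1) linear_proj_along] by (simp add: o_def)
  have "killing_field (Euclidean {x. n \<bullet> x = 1}) K"
    unfolding killing_field_def frechet_derivative_linear[OF lin]
  proof (intro conjI ballI)
    let ?M = "Euclidean {x. n \<bullet> x = 1}"
    show "\<exists>U. open U \<and> points ?M \<subseteq> U \<and> smooth_on U K"
      using smooth_on_linear[OF lin, of UNIV] by blast
    fix x assume "x \<in> points ?M"
    then have tx: "tangent_space (points ?M) x = {v. n \<bullet> v = 0}"
      by (simp add: tangent_space_hyperplane)
    show "K x \<in> tangent_space (points ?M) x"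
      unfolding tx using n by (simp add: K_def inner_proj_along)
    fix u v assume "u \<in> tangent_space (points ?M) x" "v \<in> tangent_space (points ?M) x"
    then show "metric_form ?M (K u) v + metric_form ?M u (K v) = 0"
      unfolding tx using B(2)[of u v]
      by (simp add: K_def proj_along_inner_tangent inner_commute[of u])
  qed
  then show "\<exists>K. killing_field (Euclidean {x. n \<bullet> x = 1}) K \<and> (\<forall>i. q $ i = K (p $ i))"
    using B(3) by (intro exI[of _ K]) (simp add: K_def)
qed

section \<open>The projective correspondence of deformations\<close>

text \<open>
  This is the infinitesimal Pogorelov map. The factor \<open>r\<^sub>i\<close> is the one that carries \<open>p\<^sub>i\<close> to its
  image, so that the bilinear equations of the edges are only rescaled; the projection makes the
  result tangent to the hyperplane.
\<close>

definition transfer :: "'d::finite geometry \<Rightarrow> 'd ambient \<Rightarrow> ('v \<Rightarrow> real) \<Rightarrow>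
    'd ambient ^ 'v::finite \<Rightarrow> 'd ambient ^ 'v" where
  "transfer M n r q = (\<chi> i. proj_along n (r i *\<^sub>R form_op M (q $ i)))"

lemma linear_transfer: "linear (transfer M n r)"
  by (intro linearI)
    (auto simp: transfer_def vec_eq_iff linear_add[OF linear_form_op] linear_cmul[OF linear_form_op]
      linear_add[OF linear_proj_along] linear_cmul[OF linear_proj_along] scaleR_add_right mult.commute)

text \<open>
  The images of the vertices satisfy \<open>\<langle>n, r\<^sub>i p\<^sub>i\<rangle> = 1\<close>, so their differences are orthogonal to \<open>n\<close> and
  the projection does not change the Euclidean edge equations. The same normalisation lets the lost
  normal component be recovered, which makes the map bijective between the spaces of deformations.
\<close>

lemma kinematic_dof_projection:
  fixes p pbar :: "'d::finite ambient ^ 'v::finite" and n :: "'d ambient"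
  assumes M: "M = Hyperbolic \<or> M = Spherical" and fw: "framework M E p"
    and fwbar: "framework (Euclidean {x. n \<bullet> x = 1}) E pbar" and n: "n \<noteq> 0"
    and pbar: "\<And>i. pbar $ i = r i *\<^sub>R p $ i"
  shows "kinematic_dof M E p = kinematic_dof (Euclidean {x. n \<bullet> x = 1}) E pbar"
proof -
  let ?A = "Euclidean {x. n \<bullet> x = 1}"
  let ?T = "transfer M n r"
  let ?skew = "\<lambda>B :: 'd ambient \<Rightarrow> 'd ambient. linear B \<and> (\<forall>x y. B x \<bullet> y + B y \<bullet> x = 0)"
  have nb: "n \<bullet> pbar $ i = 1" for i using fwbar by (simp add: framework_def)
  then have r0: "r i \<noteq> 0" for i using pbar[of i] by (metis inner_zero_right scale_zero_left zero_neq_one)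
  have pM: "p $ i \<in> points M" for i using fw by (simp add: framework_def)
  note D = mem_deformations_quadric[OF M fw]
  note Dbar = mem_deformations_hyperplane[OF fwbar]
  \<comment> \<open>The vertices of the image satisfy the same equations for the rescaled and reflected vectors.\<close>
  have w: "w i \<bullet> pbar $ i = 0" "{i, j} \<in> E \<Longrightarrow> w i \<bullet> pbar $ j + w j \<bullet> pbar $ i = 0"
    if "q \<in> deformations M E p" "\<And>i. w i = r i *\<^sub>R form_op M (q $ i)" for q w i j
  proof -
    show "w i \<bullet> pbar $ i = 0" using that D by (simp add: pbar)
    assume "{i, j} \<in> E"
    then have "form_op M (q $ i) \<bullet> p $ j + form_op M (q $ j) \<bullet> p $ i = 0" using that D by blast
    moreover have "w i \<bullet> pbar $ j + w j \<bullet> pbar $ i =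
        r i * r j * (form_op M (q $ i) \<bullet> p $ j + form_op M (q $ j) \<bullet> p $ i)"
      by (simp add: that pbar algebra_simps)
    ultimately show "w i \<bullet> pbar $ j + w j \<bullet> pbar $ i = 0" by simp
  qed
  have forward: "?T q \<in> deformations ?A E pbar" if q: "q \<in> deformations M E p" for q
    unfolding Dbar
  proof (intro conjI allI impI)
    define w where "w i = r i *\<^sub>R form_op M (q $ i)" for i
    have T: "?T q $ i = proj_along n (w i)" for i by (simp add: transfer_def w_def)
    show "n \<bullet> ?T q $ i = 0" for i by (simp add: T inner_proj_along n)
    fix i j assume ij: "{i, j} \<in> E"
    have "n \<bullet> (pbar $ i - pbar $ j) = 0" by (simp add: nb inner_diff_right)
    from proj_along_inner_tangent[OF this]
    have "(pbar $ i - pbar $ j) \<bullet> (?T q $ i - ?T q $ j) = (w i - w j) \<bullet> (pbar $ i - pbar $ j)"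
      unfolding T inner_commute[of "pbar $ i - pbar $ j"] inner_diff_left[of "proj_along n (w i)"]
        inner_diff_left[of "w i"] by simp
    then show "(pbar $ i - pbar $ j) \<bullet> (?T q $ i - ?T q $ j) = 0"
      using w(1)[OF q w_def, of i] w(1)[OF q w_def, of j] w(2)[OF q w_def ij] by (simp add: inner_diff_left inner_diff_right)
  qed
  \<comment> \<open>The normal component of \<open>r J q\<close> is recovered from its orthogonality to the vertex.\<close>
  have backward: "\<exists>q. q \<in> deformations M E p \<and> ?T q = qb" if qb: "qb \<in> deformations ?A E pbar" for qb
  proof (intro exI conjI)
    define w where "w i = qb $ i - (pbar $ i \<bullet> qb $ i) *\<^sub>R n" for i
    define q where "q = (\<chi> i. form_op M (w i /\<^sub>R r i))"
    have Jq: "form_op M (q $ i) = w i /\<^sub>R r i" for i by (simp add: q_def)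
    have p: "p $ i = pbar $ i /\<^sub>R r i" for i using r0 by (simp add: pbar)
    have w1: "w i \<bullet> pbar $ i = 0" for i
      using nb[of i] by (simp add: w_def inner_diff_left inner_commute[of "qb $ i"])
    have w2: "w i \<bullet> pbar $ j + w j \<bullet> pbar $ i = 0" if "{i, j} \<in> E" for i j
    proof -
      have "(pbar $ i - pbar $ j) \<bullet> (qb $ i - qb $ j) = 0" using qb that Dbar by blast
      then show ?thesis 
        using nb[of i] nb[of j]
        by (simp add: w_def inner_diff_left inner_diff_right inner_commute[of "qb $ i"] inner_commute[of "qb $ j"])
    qed
    show "q \<in> deformations M E p"
      unfolding D Jq
    proof (intro conjI allI impI)
      show "(w i /\<^sub>R r i) \<bullet> p $ i = 0" for i by (simp add: p w1)
      fix i j assume "{i, j} \<in> E"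
      have "(w i /\<^sub>R r i) \<bullet> p $ j + (w j /\<^sub>R r j) \<bullet> p $ i =
          inverse (r i) * inverse (r j) * (w i \<bullet> pbar $ j + w j \<bullet> pbar $ i)"
        by (simp add: p algebra_simps)
      then show "(w i /\<^sub>R r i) \<bullet> p $ j + (w j /\<^sub>R r j) \<bullet> p $ i = 0"
        using w2[OF \<open>{i, j} \<in> E\<close>] by simp
    qed
    show "?T q = qb"
      using qb Dbar r0 n by (auto simp: vec_eq_iff transfer_def Jq w_def proj_along_add_normal)
  qed
  have image: "?T ` deformations M E p = deformations ?A E pbar"
    using forward backward by blast
  have sub: "subspace (deformations M E p)"
    unfolding subspace_def
  proof (intro conjI ballI allI)
    show "0 \<in> deformations M E p" by (simp add: D linear_0[OF linear_form_op])
    fix q q' assume q: "q \<in> deformations M E p" and q': "q' \<in> deformations M E p"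
    have add: "form_op M ((q + q') $ i) \<bullet> x = form_op M (q $ i) \<bullet> x + form_op M (q' $ i) \<bullet> x" for i x
      by (simp add: linear_add[OF linear_form_op] inner_add_left)
    have "form_op M (q $ i) \<bullet> p $ j + form_op M (q' $ i) \<bullet> p $ j +
        (form_op M (q $ j) \<bullet> p $ i + form_op M (q' $ j) \<bullet> p $ i) = 0" if "{i, j} \<in> E" for i j
    proof -
      have "form_op M (q $ i) \<bullet> p $ j + form_op M (q $ j) \<bullet> p $ i = 0"
        "form_op M (q' $ i) \<bullet> p $ j + form_op M (q' $ j) \<bullet> p $ i = 0"
        using q q' that unfolding D by blast+
      then show ?thesis by linarith
    qed
    with q q' show "q + q' \<in> deformations M E p" unfolding D add by simp
  next
    fix c q assume q: "q \<in> deformations M E p"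
    have scale: "form_op M ((c *\<^sub>R q) $ i) \<bullet> x = c * (form_op M (q $ i) \<bullet> x)" for i x
      by (simp add: linear_cmul[OF linear_form_op])
    show "c *\<^sub>R q \<in> deformations M E p"
      using q unfolding D scale distrib_left[symmetric] by (metis mult_zero_right)
  qed
  have inj: "inj_on ?T (deformations M E p)"
  proof (subst linear_injective_on_subspace_0[OF linear_transfer sub], intro ballI impI)
    fix q assume q: "q \<in> deformations M E p" and 0: "?T q = 0"
    have "q $ i = 0" for i
    proof -
      define w where "w = r i *\<^sub>R form_op M (q $ i)"
      have "proj_along n w = ?T q $ i" by (simp add: transfer_def w_def)
      then have "proj_along n w = 0" using 0 by simp
      define a where "a = (n \<bullet> w) / (n \<bullet> n)"
      have wn: "w = a *\<^sub>R n" using \<open>proj_along n w = 0\<close> by (simp add: proj_along_def a_def)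
      have "w \<bullet> pbar $ i = 0" using w(1)[OF q refl] by (simp add: w_def)
      then have "a = 0" by (simp add: wn nb)
      then have "w = 0" using wn by simp
      then have "form_op M (q $ i) = 0" using r0 by (simp add: w_def)
      then show ?thesis by (metis form_op_form_op linear_0[OF linear_form_op])
    qed
    then show "q = 0" by (simp add: vec_eq_iff)
  qed
  have trivial: "q \<in> trivial_deformations M E p \<longleftrightarrow> q \<in> deformations M E p \<and>
      (\<exists>B. ?skew B \<and> (\<forall>i. form_op M (q $ i) = B (p $ i)))" for q
    unfolding trivial_deformations_def using killing_field_values_quadric[OF M pM, where q = q] by simp
  have trivialbar: "qb \<in> trivial_deformations ?A E pbar \<longleftrightarrow> qb \<in> deformations ?A E pbar \<and>
      (\<exists>B. ?skew B \<and> (\<forall>i. qb $ i = proj_along n (B (pbar $ i))))" for qb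
    unfolding trivial_deformations_def using killing_field_values_hyperplane[OF n nb, where q = qb] by simp
  have image_trivial: "?T ` trivial_deformations M E p = trivial_deformations ?A E pbar"
  proof (intro equalityI subsetI)
    fix qb assume "qb \<in> ?T ` trivial_deformations M E p"
    then obtain q where "q \<in> trivial_deformations M E p" and qb: "qb = ?T q" by blast
    then obtain B where q: "q \<in> deformations M E p" and B: "?skew B"
      "\<And>i. form_op M (q $ i) = B (p $ i)" unfolding trivial by blast
    have "qb $ i = proj_along n (B (pbar $ i))" for i
      using B by (simp add: qb transfer_def pbar linear_cmul)
    then show "qb \<in> trivial_deformations ?A E pbar"
      unfolding trivialbar using B(1) forward[OF q] qb by blast
  next
    fix qb assume "qb \<in> trivial_deformations ?A E pbar"
    then obtain B where B: "linear B" "\<And>x y. B x \<bullet> y + B y \<bullet> x = 0"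
      "\<And>i. qb $ i = proj_along n (B (pbar $ i))" unfolding trivialbar by blast
    define q where "q = (\<chi> i. form_op M (B (p $ i)))"
    have Jq: "form_op M (q $ i) = B (p $ i)" for i by (simp add: q_def)
    have "B x \<bullet> x = 0" for x using B(2)[of x x] by simp
    then have "q \<in> trivial_deformations M E p"
      unfolding trivial D Jq using B(1,2) by blast
    moreover have "?T q = qb"
      by (simp add: vec_eq_iff transfer_def Jq B(3) pbar linear_cmul[OF B(1)])
    ultimately show "qb \<in> ?T ` trivial_deformations M E p" by blast
  qed
  have dims: "dim (?T ` S) = dim S" if "S \<subseteq> deformations M E p" for S
  proof (rule dim_image_eq[OF linear_transfer])
    have "span S \<subseteq> deformations M E p" using that sub by (rule span_minimal)
    then show "inj_on ?T (span S)" by (rule inj_on_subset[OF inj])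
  qed
  show ?thesis
    unfolding kinematic_dof_def image[symmetric] image_trivial[symmetric]
    by (simp add: dims trivial_deformations_def)
qed

theorem theoremC:
  fixes M :: "'d::finite geometry" and E :: "'v::finite set set"
    and p pbar :: "'d ambient ^ 'v" and A :: "'d ambient set"
  assumes "simple_graph E"
    and "M = Hyperbolic \<or> M = Spherical"
    and "framework M E p"
    and "geodesic_euclidean_image M A p pbar"
  shows "kinematic_dof M E p = kinematic_dof (Euclidean A) E pbar \<and>
         (infinitesimally_rigid M E p \<longleftrightarrow> infinitesimally_rigid (Euclidean A) E pbar)"
proof -
  have fwbar: "framework (Euclidean A) E pbar"
    using assms(3,4) by (rule framework_geodesic_euclidean_image)
  obtain n :: "'d ambient" and r where n: "n \<noteq> 0" "A = {x. n \<bullet> x = 1}"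
    and r: "\<And>i. pbar $ i = r i *\<^sub>R p $ i"
    using assms(2)
  proof
    assume "M = Hyperbolic"
    then have "A = {x. (1, 0) \<bullet> x = 1}" "\<And>i. pbar $ i = (1 / fst (p $ i)) *\<^sub>R p $ i"
      using assms(4) by (auto simp: inner_prod_def)
    then show thesis 
      by (intro that[of "(1, 0)" "\<lambda>i. 1 / fst (p $ i)"]) (simp_all add: zero_prod_def)
  next
    assume "M = Spherical"
    then have A: "affine A" "aff_dim A = int CARD('d)" "0 \<notin> A" and sp: "\<And>i. pbar $ i \<in> span {p $ i}"
      using assms(4) by auto
    have "aff_dim A = int (DIM('d ambient) - 1)" using A(2) by simp
    from iffD1[OF aff_dim_eq_hyperplane this]
    obtain a b where ab: "a \<noteq> 0" "affine hull A = {x. a \<bullet> x = b}" by blast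
    have Aab: "A = {x. a \<bullet> x = b}"
      using ab(2) iffD2[OF affine_hull_eq A(1)] by (rule trans[OF sym, rotated])
    then have b: "b \<noteq> 0" using A(3) by auto
    have "A = {x. (a /\<^sub>R b) \<bullet> x = 1}" unfolding Aab using b by (auto simp: field_simps)
    moreover have "\<forall>i. \<exists>r. pbar $ i = r *\<^sub>R p $ i" using sp by (auto simp: span_singleton)
    then obtain r where "\<And>i. pbar $ i = r i *\<^sub>R p $ i" by metis
    ultimately show thesis using ab b by (intro that[of "a /\<^sub>R b" r]) auto
  qed
  have "kinematic_dof M E p = kinematic_dof (Euclidean A) E pbar"
    using kinematic_dof_projection[OF assms(2,3) _ n(1) r] fwbar unfolding n(2) by blast
  then show ?thesis by (simp add: infinitesimally_rigid_def)
qed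

end
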